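(* Consider the problem of estimating the parameter $\rho\in(0,\infty)$ based on realizations $s_1,\dots,s_n$ of random strings $\sigma_1=\{\alpha_{1j}:j\in\mathbb{Z}^{+}\},\dots,\sigma_n=\{\alpha_{nj}:j\in\mathbb{Z}^{+}\}$ that (i) are distributed according to the Laplace-like distribution $L_{A^{\ast}}(\lambda,\rho)$. (a) If $\lambda$ is known, (ii) $d\in D$ is arbitrary, and (iii) $\sigma_1,\dots,\sigma_n$ are independent, then $$\frac1n\sum_{i=1}^n d(s_i,\lambda)\longrightarrow\rho\quad\text{a.s. as }n\to\infty.$$ (b) If $\lambda$ is unknown, (ii$'$) $d=d_{H'}$, and (iii$'$) $\alpha_{1j},\dots,\alpha_{nj}$ are independent for each $j\in\mathbb{Z}^{+}$, then $$\frac1n\sum_{i=1}^n d_{H'}\bigl(s_i,\boldsymbol m_c^{(\epsilon)}(s_1,\dots,s_n)\bigr)\longrightarrow\rho\quad\text{a.s. as }n\to\infty\text{ and }\epsilon\to0,$$ where $\boldsymbol m_c^{(\epsilon)}(s_1,\dots,s_n)$ is the truncated consensus sequence.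
   Context: **Strings.** $A=\{a_1,\dots,a_{z-1}\}$ is a finite alphabet, $e$ the empty letter, $a_z=e$, $\bar A=A\cup\{e\}$. A string on $A$ is a sequence $s=\{x_j\in\bar A:j\in\mathbb{Z}^{+}\}$ such that $x_h=e$ for some $h$, and $x_j=e$ implies $x_{j+1}=e$; $A^{\ast}$ is the set of strings; $o=e\cdots$. $D$ is the set of distance functions on $A^{\ast}$ with values in $\mathbb{N}=\{0,1,\dots\}$. $d_{H'}(s,t)$ (extended Hamming distance) is the number of sites $j$ at which $s$ and $t$ differ (empty letters included). **Laplace-like distribution.** For $d\in D$, with $\partial U(\lambda,r)=\{t\in A^{\ast}:d(\lambda,t)=r\}$, $L_{A^{\ast}}(\lambda,\rho)$ ($\lambda\in A^{\ast}$, $\rho\in(0,\infty)$) has probability function $q(s;\lambda,\rho)=\frac{1}{(\rho+1)|\partial U(\lambda,d(s,\lambda))|}\left(\frac{\rho}{\rho+1}\right)^{d(s,\lambda)}$. **Random strings.** A random string is a sequence $\sigma=\{\alpha_j:j\in\mathbb{Z}^{+}\}$ of $\bar A$-valued random variables on a probability space such that every realization is a string. $\sigma_1,\dots,\sigma_n$ are independent if $\{\alpha_{1j}:j\in J_1\},\dots,\{\alpha_{nj}:j\in J_n\}$ are independent for any nonempty finite $J_1,\dots,J_n\subset\mathbb{Z}^{+}$. **Truncated consensus sequence.** Let $f_{jh}$ be the relative frequency of $a_h$ at the $j$-th site of $s_1,\dots,s_n$ ($1\le h\le z$). Put $j^{\ast}=\min\{j\in\mathbb{Z}^{+}:f_{jz}=\max_{1\le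 h\le z}f_{jh}\}-1$. For $\epsilon>0$, if $j^{\ast}\ge1$, condition $\mathrm{U}^{(\epsilon)}$ says: there exists $j\in\{1,\dots,j^{\ast}\}$ such that for every $j'\in\{j,\dots,j^{\ast}\}$, $\max_{1\le h\le z-1}f_{j'h}-\min_{1\le h\le z-1}f_{j'h}<\epsilon$. If it holds, $j^{(\epsilon)}$ is (the smallest such $j$) $-1$. Let $\eta(j)=\arg\max_{1\le h\le z}f_{jh}$ (an arbitrary maximizer if not unique). Then $\boldsymbol m_c^{(\epsilon)}(s_1,\dots,s_n)$ is: $o$ if $j^{\ast}=0$, or if $j^{\ast}\ge1$, $\mathrm{U}^{(\epsilon)}$ holds and $j^{(\epsilon)}=0$; $a_{\eta(1)}\cdots a_{\eta(j^{\ast})}e\cdots$ if $j^{\ast}\ge1$ and $\mathrm{U}^{(\epsilon)}$ fails; $a_{\eta(1)}\cdots a_{\eta(j^{(\epsilon)})}e\cdots$ if $j^{\ast}\ge1$, $\mathrm{U}^{(\epsilon)}$ holds and $j^{(\epsilon)}\ge1$.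
   Formalization: Part (b) assumes the alphabet A has at least two letters (with one letter the truncated consensus is always o, so the claim fails for every nonempty λ), and "n→∞ and ε→0" is the iterated limit, n first, then ε (the joint limit can fail). *)

theory Defs
  imports "HOL-Probability.Probability"
begin

text \<open>
  The alphabet is a finite type \<open>'a\<close>; the extended alphabet is \<open>'a option\<close>, with
  \<open>None\<close> as the empty letter. Sites are numbered from 0, so that index \<open>j\<close> here is site
  \<open>j + 1\<close> in the usual numbering by positive integers. Likewise samples are numbered from 0.
\<close>

typedef 'a astring =
  "{x :: nat \<Rightarrow> 'a option. (\<exists>h. x h = None) \<and> (\<forall>j. x j = None \<longrightarrow> x (Suc j) = None)}"
  morphisms site Abs_astring
  by (rule exI[of _ "\<lambda>_. None"]) simp

definition empty_astring :: "'a astring" where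
  "empty_astring = Abs_astring (\<lambda>_. None)"

text \<open>Meaningful only if \<open>x j \<noteq> None\<close> for all \<open>j < m\<close>.\<close>

definition prefix_astring :: "(nat \<Rightarrow> 'a option) \<Rightarrow> nat \<Rightarrow> 'a astring" where
  "prefix_astring x m = Abs_astring (\<lambda>j. if j < m then x j else None)"

definition distance_functions :: "('a astring \<Rightarrow> 'a astring \<Rightarrow> nat) set" where
  "distance_functions = {d. Metric_space UNIV (\<lambda>s t. real (d s t))}"

definition ext_hamming :: "'a astring \<Rightarrow> 'a astring \<Rightarrow> nat" where
  "ext_hamming s t = card {j. site s j \<noteq> site t j}"

definition dist_sphere :: "('a astring \<Rightarrow> 'a astring \<Rightarrow> nat) \<Rightarrow> 'a astring \<Rightarrow> nat \<Rightarrow> 'a astring set"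
  where "dist_sphere d lam r = {t. d lam t = r}"

text \<open>
  If a sphere is infinite, its \<open>card\<close> is 0 and the value below is 0 on it, in agreement with
  reading 1 over an infinite cardinality as 0. The values sum to 1 exactly if all spheres around
  \<open>lam\<close> are finite and nonempty.
\<close>

definition laplace_like_pf ::
  "('a astring \<Rightarrow> 'a astring \<Rightarrow> nat) \<Rightarrow> 'a astring \<Rightarrow> real \<Rightarrow> 'a astring \<Rightarrow> real" where
  "laplace_like_pf d lam \<rho> s =
     1 / ((\<rho> + 1) * real (card (dist_sphere d lam (d s lam)))) * (\<rho> / (\<rho> + 1)) ^ d s lam"

definition random_string :: "'w measure \<Rightarrow> ('w \<Rightarrow> 'a astring) \<Rightarrow> bool" where
  "random_string M \<sigma> \<longleftrightarrow> (\<forall>j. (\<lambda>\<omega>. site (\<sigma> \<omega>) j) \<in> M \<rightarrow>\<^sub>M count_space UNIV)"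

definition laplace_like_distributed ::
  "'w measure \<Rightarrow> ('w \<Rightarrow> 'a astring) \<Rightarrow> ('a astring \<Rightarrow> 'a astring \<Rightarrow> nat) \<Rightarrow> 'a astring \<Rightarrow> real \<Rightarrow> bool"
  where "laplace_like_distributed M \<sigma> d lam \<rho> \<longleftrightarrow>
     (\<forall>s. measure M {\<omega> \<in> space M. \<sigma> \<omega> = s} = laplace_like_pf d lam \<rho> s)"

definition indep_random_strings :: "'w measure \<Rightarrow> (nat \<Rightarrow> 'w \<Rightarrow> 'a astring) \<Rightarrow> nat \<Rightarrow> bool" where
  "indep_random_strings M \<sigma> n \<longleftrightarrow>
     (\<forall>J :: nat \<Rightarrow> nat set. (\<forall>i<n. finite (J i) \<and> J i \<noteq> {}) \<longrightarrow>
        prob_space.indep_vars M (\<lambda>i. PiM (J i) (\<lambda>_. count_space UNIV))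
          (\<lambda>i \<omega>. \<lambda>j\<in>J i. site (\<sigma> i \<omega>) j) {..<n})"

definition rel_freq :: "'a astring list \<Rightarrow> nat \<Rightarrow> 'a option \<Rightarrow> real" where
  "rel_freq ss j x = real (card {i. i < length ss \<and> site (ss ! i) j = x}) / real (length ss)"

text \<open>
  With sites numbered from 0, the smallest admissible index is already one less than in the
  usual numbering; hence no subtraction of 1 in \<open>j_star\<close> and \<open>j_trunc\<close>.
\<close>

definition j_star :: "'a::finite astring list \<Rightarrow> nat" where
  "j_star ss = (LEAST j. rel_freq ss j None = Max (range (rel_freq ss j)))"

definition uniform_from :: "real \<Rightarrow> 'a::finite astring list \<Rightarrow> nat \<Rightarrow> bool" where
  "uniform_from \<epsilon> ss j \<longleftrightarrow>
     (\<forall>j'\<in>{j..<j_star ss}.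
        Max (range (\<lambda>a. rel_freq ss j' (Some a))) - Min (range (\<lambda>a. rel_freq ss j' (Some a))) < \<epsilon>)"

definition cond_U :: "real \<Rightarrow> 'a::finite astring list \<Rightarrow> bool" where
  "cond_U \<epsilon> ss \<longleftrightarrow> (\<exists>j<j_star ss. uniform_from \<epsilon> ss j)"

definition j_trunc :: "real \<Rightarrow> 'a::finite astring list \<Rightarrow> nat" where
  "j_trunc \<epsilon> ss = (LEAST j. j < j_star ss \<and> uniform_from \<epsilon> ss j)"

text \<open>A rule that picks, for every sample and site, an arbitrary letter of maximal frequency.\<close>

definition mode_rule :: "('a astring list \<Rightarrow> nat \<Rightarrow> 'a option) \<Rightarrow> bool" where
  "mode_rule \<eta> \<longleftrightarrow> (\<forall>ss j. is_arg_max (rel_freq ss j) (\<lambda>_. True) (\<eta> ss j))"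

definition trunc_consensus ::
  "('a::finite astring list \<Rightarrow> nat \<Rightarrow> 'a option) \<Rightarrow> real \<Rightarrow> 'a astring list \<Rightarrow> 'a astring" where
  "trunc_consensus \<eta> \<epsilon> ss =
     (if j_star ss = 0 \<or> (cond_U \<epsilon> ss \<and> j_trunc \<epsilon> ss = 0) then empty_astring
      else if \<not> cond_U \<epsilon> ss then prefix_astring (\<eta> ss) (j_star ss)
      else prefix_astring (\<eta> ss) (j_trunc \<epsilon> ss))"

end

theory Submission
  imports Defs "HOL-Library.Discrete_Functions"
begin

text \<open>
  Both parts rest on one law of large numbers: if nonnegative variables \<open>Y i\<close> satisfy
  \<open>E (Y 0 + \<dots> + Y (n - 1) - n \<mu>)\<^sup>2 \<le> C n\<close> for all \<open>n\<close>, then their averages tend to \<open>\<mu>\<close> almost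
  surely (\<open>AE_averages_tendsto_if_variance_linear\<close>). It speaks only of the variance of the
  partial sums, so it also covers variables that are not independent, which part (b) requires.

  Under a Laplace-like law the distance \<open>D\<close> to the centre is geometric with mean \<open>\<rho>\<close>, for every
  \<open>d\<close>: the law gives mass at most \<open>(1 / (\<rho> + 1)) (\<rho> / (\<rho> + 1))\<^sup>r\<close> to the sphere of radius \<open>r\<close>, and
  since these bounds sum to 1, all of them are attained
  (\<open>map_pmf_distance_eq_geometric\<close>). In part (a) the strings are moreover pairwise independent,
  because the event that a string equals \<open>s\<close> depends on the first \<open>slen s + 1\<close> sites only; hence
  the variance of a sum of \<open>n\<close> distances is linear in \<open>n\<close>.

  In part (b) independence holds at each site separately, and the \<open>n\<close> distances may depend on
  each other across sites. The distance is a sum over the sites \<open>j\<close> of mismatch indicators with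
  mean \<open>p j\<close>. At each site the centred sum over the sample has second moment at most \<open>n p j\<close>, and
  \<open>p j\<close> decays geometrically, so that the triangle inequality in \<open>L\<^sup>2\<close>, in the form of a weighted
  Cauchy-Schwarz inequality, again bounds the variance of the total by a multiple of \<open>n\<close>
  (\<open>AE_mean_distance_to_centre_tendsto\<close>). Thus the mean distance to the true centre tends to \<open>\<rho>\<close>.

  It remains to see that the truncated consensus sequence is eventually equal to the centre
  \<open>lam\<close> once \<open>\<epsilon>\<close> is small. By the same law of large numbers the site frequencies converge to the
  site probabilities under the common law. At a site inside \<open>lam\<close> the letter of \<open>lam\<close> is the strict
  mode: a distance preserving injection maps the strings with another entry there to strings with
  the entry of \<open>lam\<close> and misses \<open>lam\<close> itself (\<open>centre_letter_strict_mode\<close>). At a site beyond the end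
  of \<open>lam\<close> all letters are equally likely, by exchanging two letters
  (\<open>prob_letter_eq_beyond_centre\<close>). The empty letter need not be the mode there: for the empty
  centre and \<open>\<rho>\<close> greater than the number of letters, each letter is more likely than the empty one
  at the first site. So the untruncated consensus can be longer than \<open>lam\<close>, but it has
  bounded length, the letter frequencies on its superfluous sites are nearly uniform, and they are
  not so on the last site of \<open>lam\<close>; this is why the truncation cuts at exactly \<open>slen lam\<close>
  (\<open>eventually_trunc_consensus_eq\<close>).
\<close>

section \<open>A law of large numbers from a linear variance bound\<close>

text \<open>
  Between consecutive squares \<open>k\<^sup>2 \<le> n < (k + 1)\<^sup>2\<close> a nonnegative monotone sequence is squeezed between
  its values at the two squares, and replacing the denominator costs only a factor that tends to 1.
\<close>

lemma averages_tendsto_if_squares: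
  fixes S :: "nat \<Rightarrow> real"
  assumes mono: "mono S" and nonneg: "\<And>n. 0 \<le> S n"
    and sq: "(\<lambda>k. S ((Suc k)\<^sup>2) / real ((Suc k)\<^sup>2)) \<longlonglongrightarrow> \<mu>"
  shows "(\<lambda>n. S n / real n) \<longlonglongrightarrow> \<mu>"
proof -
  define r where "r = (\<lambda>k. real (Suc k) / real k)"
  define u where "u = (\<lambda>k. S (k\<^sup>2) / real (k\<^sup>2))"
  have r: "r \<longlonglongrightarrow> 1"
    unfolding r_def by real_asymp
  have u: "u \<longlonglongrightarrow> \<mu>"
    using sq by (subst filterlim_sequentially_Suc[symmetric]) (simp add: u_def)
  have uS: "(\<lambda>k. u (Suc k)) \<longlonglongrightarrow> \<mu>"
    using u by (rule LIMSEQ_Suc)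
  have fs: "filterlim floor_sqrt sequentially sequentially"
    unfolding filterlim_at_top
  proof
    fix z show "\<forall>\<^sub>F n in sequentially. z \<le> floor_sqrt n"
      using eventually_ge_at_top[of "z\<^sup>2"] by eventually_elim (rule le_floor_sqrtI)
  qed
  have low: "(\<lambda>n. u (floor_sqrt n) / (r (floor_sqrt n))\<^sup>2) \<longlonglongrightarrow> \<mu>"
    using tendsto_divide[OF filterlim_compose[OF u fs] tendsto_power[OF filterlim_compose[OF r fs], of 2]]
    by simp
  have up: "(\<lambda>n. u (Suc (floor_sqrt n)) * (r (floor_sqrt n))\<^sup>2) \<longlonglongrightarrow> \<mu>"
    using tendsto_mult[OF filterlim_compose[OF uS fs] tendsto_power[OF filterlim_compose[OF r fs], of 2]]
    by simp
  show ?thesis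
  proof (rule tendsto_sandwich[OF _ _ low up])
    show "\<forall>\<^sub>F n in sequentially. u (floor_sqrt n) / (r (floor_sqrt n))\<^sup>2 \<le> S n / real n"
      using eventually_gt_at_top[of 0]
    proof eventually_elim
      case (elim n)
      define k where "k = floor_sqrt n"
      have k: "0 < k" "k\<^sup>2 \<le> n" "n < (Suc k)\<^sup>2"
        using elim Suc_floor_sqrt_power2_gt[of n] by (auto simp: k_def)
      have "u k / (r k)\<^sup>2 = S (k\<^sup>2) / real ((Suc k)\<^sup>2)"
        using k(1) by (simp add: u_def r_def power_divide del: of_nat_Suc)
      also have "\<dots> \<le> S n / real n"
        using monoD[OF mono k(2)] nonneg k elim by (intro frac_le) (simp_all del: of_nat_power)
      finally show ?case by (simp add: k_def)
    qed
    show "\<forall>\<^sub>F n in sequentially. S n / real n \<le> u (Suc (floor_sqrt n)) * (r (floor_sqrt n))\<^sup>2"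
      using eventually_gt_at_top[of 0]
    proof eventually_elim
      case (elim n)
      define k where "k = floor_sqrt n"
      have k: "0 < k" "k\<^sup>2 \<le> n" "n \<le> (Suc k)\<^sup>2"
        using elim Suc_floor_sqrt_power2_gt[of n] by (auto simp: k_def)
      have "S n / real n \<le> S ((Suc k)\<^sup>2) / real (k\<^sup>2)"
        using monoD[OF mono k(3)] nonneg k elim by (intro frac_le) (simp_all del: of_nat_power)
      also have "\<dots> = u (Suc k) * (r k)\<^sup>2"
        using k(1) by (simp add: u_def r_def power_divide del: of_nat_Suc)
      finally show ?case by (simp add: k_def)
    qed
  qed
qed

text \<open>
  The mean square error of the average over \<open>n\<close> variables is at most \<open>C / n\<close>, which is summable
  along the squares; there the squared errors have an almost surely finite sum and tend to 0.
\<close>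

lemma AE_averages_tendsto_if_variance_linear:
  fixes Y :: "nat \<Rightarrow> 'w \<Rightarrow> real"
  assumes meas [measurable]: "\<And>i. Y i \<in> borel_measurable M"
    and nonneg: "\<And>i \<omega>. 0 \<le> Y i \<omega>" and C: "0 \<le> C"
    and var: "\<And>n. (\<integral>\<^sup>+\<omega>. ennreal (((\<Sum>i<n. Y i \<omega>) - real n * \<mu>)\<^sup>2) \<partial>M) \<le> ennreal (C * real n)"
  shows "AE \<omega> in M. (\<lambda>n. (1 / real n) * (\<Sum>i<n. Y i \<omega>)) \<longlonglongrightarrow> \<mu>"
proof -
  define G where "G = (\<lambda>k \<omega>. ((\<Sum>i<(Suc k)\<^sup>2. Y i \<omega>) / real ((Suc k)\<^sup>2) - \<mu>)\<^sup>2)"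
  have [measurable]: "G k \<in> borel_measurable M" for k
    unfolding G_def by measurable
  have G: "(\<integral>\<^sup>+\<omega>. ennreal (G k \<omega>) \<partial>M) \<le> ennreal (C / real (Suc k) ^ 2)" for k
  proof -
    define n where "n = (Suc k)\<^sup>2"
    have n: "0 < n" by (simp add: n_def)
    have eq: "G k \<omega> = (1 / (real n)\<^sup>2) * ((\<Sum>i<n. Y i \<omega>) - real n * \<mu>)\<^sup>2" for \<omega>
      using n unfolding G_def n_def[symmetric] by (simp add: field_simps power2_eq_square)
    have "(\<integral>\<^sup>+\<omega>. ennreal (G k \<omega>) \<partial>M)
        = ennreal (1 / (real n)\<^sup>2) * (\<integral>\<^sup>+\<omega>. ennreal (((\<Sum>i<n. Y i \<omega>) - real n * \<mu>)\<^sup>2) \<partial>M)"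
      by (simp add: eq ennreal_mult nn_integral_cmult del: times_divide_eq_left)
    also have "\<dots> \<le> ennreal (1 / (real n)\<^sup>2) * ennreal (C * real n)"
      by (intro mult_left_mono var) simp
    also have "\<dots> = ennreal (C / real n)"
      using n C by (subst ennreal_mult[symmetric]) (auto simp: power2_eq_square)
    finally show ?thesis by (simp add: n_def)
  qed
  have summ: "summable (\<lambda>k. C / real (Suc k) ^ 2)"
    using summable_mult[OF inverse_power_summable[of 2, where ?'a=real], of C]
    by (subst summable_Suc_iff) (simp add: field_simps)
  have "(\<integral>\<^sup>+\<omega>. (\<Sum>k. ennreal (G k \<omega>)) \<partial>M) = (\<Sum>k. \<integral>\<^sup>+\<omega>. ennreal (G k \<omega>) \<partial>M)"
    by (rule nn_integral_suminf) measurable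
  also have "\<dots> \<le> (\<Sum>k. ennreal (C / real (Suc k) ^ 2))"
    by (intro suminf_le G) auto
  also have "\<dots> < \<infinity>"
    using C by (subst suminf_ennreal2[OF _ summ]) (simp_all del: of_nat_Suc)
  finally have "AE \<omega> in M. (\<Sum>k. ennreal (G k \<omega>)) \<noteq> \<infinity>"
    by (intro nn_integral_PInf_AE) auto
  then show ?thesis
  proof eventually_elim
    case (elim \<omega>)
    have "summable (\<lambda>k. G k \<omega>)"
      using elim by (intro summable_suminf_not_top) (auto simp: G_def)
    hence "(\<lambda>k. sqrt (G k \<omega>)) \<longlonglongrightarrow> sqrt 0"
      by (intro tendsto_real_sqrt summable_LIMSEQ_zero)
    hence "(\<lambda>k. (\<Sum>i<(Suc k)\<^sup>2. Y i \<omega>) / real ((Suc k)\<^sup>2) - \<mu>) \<longlonglongrightarrow> 0"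
      by (simp add: G_def tendsto_rabs_zero_iff)
    hence "(\<lambda>k. (\<Sum>i<(Suc k)\<^sup>2. Y i \<omega>) / real ((Suc k)\<^sup>2)) \<longlonglongrightarrow> \<mu>"
      by (rule LIM_zero_cancel)
    hence "(\<lambda>n. (\<Sum>i<n. Y i \<omega>) / real n) \<longlonglongrightarrow> \<mu>"
      by (intro averages_tendsto_if_squares monoI sum_mono2 sum_nonneg nonneg) auto
    thus ?case by simp
  qed
qed

context prob_space
begin

lemma nn_integral_centred_sum_square_le:
  fixes Y :: "nat \<Rightarrow> 'a \<Rightarrow> real"
  assumes int: "\<And>i. integrable M (Y i)" and mean: "\<And>i. expectation (Y i) = \<mu>"
    and int2: "\<And>i. integrable M (\<lambda>\<omega>. (Y i \<omega>)\<^sup>2)" and var: "\<And>i. variance (Y i) \<le> v"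
    and indep: "\<And>i k. i \<noteq> k \<Longrightarrow> indep_var borel (Y i) borel (Y k)"
  shows "(\<integral>\<^sup>+\<omega>. ennreal (((\<Sum>i<n. Y i \<omega>) - real n * \<mu>)\<^sup>2) \<partial>M) \<le> ennreal (v * real n)"
proof -
  define Z where "Z = (\<lambda>i \<omega>. Y i \<omega> - \<mu>)"
  have intZ: "integrable M (Z i)" and meanZ: "expectation (Z i) = 0" for i
    unfolding Z_def using int mean by (auto simp: prob_space)
  have indepZ: "indep_var borel (Z i) borel (Z k)" if "i \<noteq> k" for i k
    using indep_var_compose[OF indep[OF that], of "\<lambda>x. x - \<mu>" borel "\<lambda>x. x - \<mu>" borel]
    by (simp add: Z_def comp_def)
  have ZZ: "integrable M (\<lambda>\<omega>. Z i \<omega> * Z k \<omega>) \<and>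
      expectation (\<lambda>\<omega>. Z i \<omega> * Z k \<omega>) \<le> (if i = k then v else 0)" for i k
  proof (cases "i = k")
    case True
    have "integrable M (\<lambda>\<omega>. (Y i \<omega>)\<^sup>2 - 2 * \<mu> * Y i \<omega> + \<mu>\<^sup>2)"
      using int int2 by auto
    moreover have "Z i \<omega> * Z i \<omega> = (Y i \<omega>)\<^sup>2 - 2 * \<mu> * Y i \<omega> + \<mu>\<^sup>2" for \<omega>
      by (simp add: Z_def power2_eq_square algebra_simps)
    ultimately show ?thesis
      using True var[of i] mean[of i] by (simp add: Z_def power2_eq_square)
  next
    case False
    show ?thesis
      using indep_var_integrable[OF indepZ[OF False] intZ intZ]
        indep_var_lebesgue_integral[OF indepZ[OF False] intZ intZ] False
      by (simp add: meanZ)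
  qed
  have eq: "((\<Sum>i<n. Y i \<omega>) - real n * \<mu>)\<^sup>2 = (\<Sum>i<n. \<Sum>k<n. Z i \<omega> * Z k \<omega>)" for \<omega>
  proof -
    have "(\<Sum>i<n. Y i \<omega>) - real n * \<mu> = (\<Sum>i<n. Z i \<omega>)"
      by (simp add: Z_def sum_subtractf)
    thus ?thesis by (simp only: power2_eq_square sum_product)
  qed
  have "(\<integral>\<^sup>+\<omega>. ennreal (((\<Sum>i<n. Y i \<omega>) - real n * \<mu>)\<^sup>2) \<partial>M)
      = ennreal (expectation (\<lambda>\<omega>. ((\<Sum>i<n. Y i \<omega>) - real n * \<mu>)\<^sup>2))"
  proof (rule nn_integral_eq_integral)
    show "integrable M (\<lambda>\<omega>. ((\<Sum>i<n. Y i \<omega>) - real n * \<mu>)\<^sup>2)"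
      unfolding eq by (intro Bochner_Integration.integrable_sum conjunct1[OF ZZ])
  qed simp
  also have "expectation (\<lambda>\<omega>. ((\<Sum>i<n. Y i \<omega>) - real n * \<mu>)\<^sup>2)
      = (\<Sum>i<n. \<Sum>k<n. expectation (\<lambda>\<omega>. Z i \<omega> * Z k \<omega>))"
    unfolding eq
    by (subst Bochner_Integration.integral_sum,
        intro Bochner_Integration.integrable_sum conjunct1[OF ZZ],
        intro sum.cong refl Bochner_Integration.integral_sum conjunct1[OF ZZ])
  also have "\<dots> \<le> (\<Sum>i<n. \<Sum>k<n. if i = k then v else 0)"
    by (intro sum_mono conjunct2[OF ZZ])
  also have "\<dots> = v * real n" by simp
  finally show ?thesis by (simp add: ennreal_leI)
qed

end

section \<open>Strings as a countable set\<close>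

lemma site_None_mono:
  assumes "site s j = None" "j \<le> k"
  shows "site s k = None"
  using assms(2)
proof (induction rule: dec_induct)
  case (step n)
  then show ?case using site[of s] by simp
qed (rule assms(1))

definition slen :: "'a astring \<Rightarrow> nat" where
  "slen s = (LEAST h. site s h = None)"

lemma site_eq_None_iff: "site s j = None \<longleftrightarrow> slen s \<le> j"
proof
  assume "site s j = None"
  thus "slen s \<le> j" unfolding slen_def by (rule Least_le)
next
  have "\<exists>h. site s h = None" using site[of s] by auto
  hence "site s (slen s) = None" unfolding slen_def by (rule LeastI_ex)
  thus "slen s \<le> j \<Longrightarrow> site s j = None" by (rule site_None_mono)
qed

lemma astring_eqI: "(\<And>j. site s j = site t j) \<Longrightarrow> s = t"
  by (metis ext site_inject)

lemma site_prefix_astring: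
  assumes "\<And>j. j < m \<Longrightarrow> x j \<noteq> None"
  shows "site (prefix_astring x m) j = (if j < m then x j else None)"
proof -
  have "(\<lambda>j. if j < m then x j else None) \<in> {x. (\<exists>h. x h = None) \<and> (\<forall>j. x j = None \<longrightarrow> x (Suc j) = None)}"
  proof (intro CollectI conjI allI impI exI[of _ m])
    fix j
    assume "(if j < m then x j else None) = None"
    hence "\<not> j < m" using assms[of j] by auto
    thus "(if Suc j < m then x (Suc j) else None) = None" by simp
  qed simp
  thus ?thesis
    by (simp add: prefix_astring_def Abs_astring_inverse)
qed

lemma slen_prefix_astring:
  assumes "\<And>j. j < m \<Longrightarrow> x j \<noteq> None"
  shows "slen (prefix_astring x m) = m"
proof -
  have "slen (prefix_astring x m) \<le> j \<longleftrightarrow> m \<le> j" for j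
    using assms by (auto simp: site_eq_None_iff[symmetric] site_prefix_astring)
  thus ?thesis by (meson le_refl order_antisym)
qed

lemma prefix_astring_eq:
  assumes "\<And>j. j < slen s \<Longrightarrow> x j = site s j"
  shows "prefix_astring x (slen s) = s"
proof (rule astring_eqI)
  have "x j \<noteq> None" if "j < slen s" for j
    using that assms[OF that] site_eq_None_iff[of s j] by simp
  then show "site (prefix_astring x (slen s)) j = site s j" for j
    using assms site_eq_None_iff[of s j] by (auto simp: site_prefix_astring)
qed

lemma empty_astring_eq: "slen s = 0 \<Longrightarrow> empty_astring = s"
  using prefix_astring_eq[of s "\<lambda>_. None"] by (simp add: empty_astring_def prefix_astring_def)

lemma astring_eq_iff_initial: "s = t \<longleftrightarrow> (\<forall>j\<le>slen t. site s j = site t j)"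
proof
  assume *: "\<forall>j\<le>slen t. site s j = site t j"
  show "s = t"
  proof (rule astring_eqI)
    fix j
    show "site s j = site t j"
    proof (cases "j \<le> slen t")
      case False
      have "site s (slen t) = None"
        using * site_eq_None_iff[of t "slen t"] by simp
      moreover have "site t (slen t) = None"
        by (simp add: site_eq_None_iff)
      ultimately have "site s j = None" "site t j = None"
        using False by (auto elim!: site_None_mono)
      thus ?thesis by simp
    qed (use * in blast)
  qed
qed auto

lemma countable_astring: "countable (UNIV :: 'a::finite astring set)"
proof (rule countableI')
  let ?f = "\<lambda>s :: 'a astring. to_nat_on (UNIV :: 'a option list set) (map (site s) [0..<Suc (slen s)])"
  have c: "countable (UNIV :: 'a option list set)"
    using countable_lists[of "UNIV :: 'a option set"] by (simp add: countable_finite)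
  show "inj ?f"
  proof (rule injI)
    fix s t :: "'a astring"
    assume "?f s = ?f t"
    hence eq: "map (site s) [0..<Suc (slen s)] = map (site t) [0..<Suc (slen t)]"
      by (intro inj_onD[OF inj_on_to_nat_on[OF c]]) auto
    have len: "slen s = slen t"
      using arg_cong[OF eq, of length] by simp
    have "\<forall>j\<le>slen t. site s j = site t j"
      using eq unfolding len map_eq_conv by (auto simp del: upt_Suc)
    thus "s = t" by (simp add: astring_eq_iff_initial)
  qed
qed

lemma random_string_measurable:
  fixes \<sigma> :: "'w \<Rightarrow> 'a::finite astring"
  assumes "random_string M \<sigma>"
  shows "\<sigma> \<in> M \<rightarrow>\<^sub>M count_space UNIV"
proof -
  have [measurable]: "(\<lambda>\<omega>. site (\<sigma> \<omega>) j) \<in> M \<rightarrow>\<^sub>M count_space UNIV" for j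
    using assms by (simp add: random_string_def)
  have "\<sigma> -` {s} \<inter> space M = {\<omega> \<in> space M. \<forall>j\<in>{..slen s}. site (\<sigma> \<omega>) j = site s j}" for s
    using astring_eq_iff_initial[of _ s] by auto
  moreover have "{\<omega> \<in> space M. \<forall>j\<in>{..slen s}. site (\<sigma> \<omega>) j = site s j} \<in> sets M" for s
    by measurable
  ultimately show ?thesis
    by (subst measurable_count_space_eq_countable[OF countable_astring]) auto
qed

section \<open>The law of the distance to the centre\<close>

text \<open>
  There are only countably many strings, so the point masses add up to 1 and determine the law.
\<close>

lemma common_law_pmf:
  fixes \<sigma> :: "nat \<Rightarrow> 'w \<Rightarrow> 'a::finite astring"
  assumes "prob_space M" and rs: "\<And>i. random_string M (\<sigma> i)"
    and law: "\<And>i. laplace_like_distributed M (\<sigma> i) d lam \<rho>"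
  obtains Q where "\<And>s. pmf Q s = laplace_like_pf d lam \<rho> s"
    and "\<And>i. distr M (count_space UNIV) (\<sigma> i) = measure_pmf Q"
proof -
  interpret prob_space M by fact
  note [measurable] = random_string_measurable[OF rs]
  define N where "N = (\<lambda>i. distr M (count_space UNIV) (\<sigma> i))"
  have N: "measure (N i) {s} = laplace_like_pf d lam \<rho> s" for i s
  proof -
    have "measure (N i) {s} = measure M {\<omega> \<in> space M. \<sigma> i \<omega> = s}"
      unfolding N_def by (subst measure_distr) (auto intro!: arg_cong[of _ _ "measure M"])
    thus ?thesis using law by (simp add: laplace_like_distributed_def)
  qed
  interpret N: prob_space "N i" for i
    unfolding N_def by (rule prob_space_distr) measurable
  have [simp]: "sets (N i) = UNIV" "space (N i) = UNIV" for i by (simp_all add: N_def)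
  have emN: "emeasure (N i) {s} = ennreal (laplace_like_pf d lam \<rho> s)" for i s
    using N[of i s] by (simp add: N.emeasure_eq_measure)
  have nonneg: "0 \<le> laplace_like_pf d lam \<rho> s" for s
    using N[of 0 s] by (metis measure_nonneg)
  have total: "(\<integral>\<^sup>+s. ennreal (laplace_like_pf d lam \<rho> s) \<partial>count_space UNIV) = 1"
    using emeasure_countable_singleton[of UNIV "N 0"] countable_astring N.emeasure_space_1[of 0]
    by (simp add: emN)
  let ?Q = "embed_pmf (laplace_like_pf d lam \<rho>)"
  have Q: "pmf ?Q s = laplace_like_pf d lam \<rho> s" for s
    by (rule pmf_embed_pmf[OF nonneg total])
  moreover have "N i = measure_pmf ?Q" for i
    by (rule measure_eqI_countable[of _ UNIV])
      (use countable_astring in \<open>auto simp: emN Q emeasure_pmf_single\<close>)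
  ultimately show ?thesis
    using that[of ?Q] by (simp add: N_def)
qed

lemma prob_pmf_mono:
  assumes "\<And>x. x \<in> A \<Longrightarrow> pmf p x \<le> pmf q x"
  shows "measure_pmf.prob p A \<le> measure_pmf.prob q A"
proof -
  have "emeasure (measure_pmf p) A \<le> emeasure (measure_pmf q) A"
    unfolding nn_integral_pmf[symmetric]
    by (intro nn_integral_mono ennreal_leI) (use assms in auto)
  thus ?thesis
    by (simp add: measure_pmf.emeasure_eq_measure)
qed

lemma pmf_eq_if_le:
  assumes le: "\<And>x. pmf p x \<le> pmf q x"
  shows "p = q"
proof (rule pmf_eqI, rule antisym[OF le])
  fix x
  have "measure_pmf.prob p (UNIV - {x}) \<le> measure_pmf.prob q (UNIV - {x})"
    by (intro prob_pmf_mono le)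
  thus "pmf q x \<le> pmf p x"
    using measure_pmf.prob_compl[of "{x}" p] measure_pmf.prob_compl[of "{x}" q]
    by (simp add: measure_pmf_single)
qed

text \<open>
  The \<open>card\<close> of an infinite sphere is 0, so its points have mass 0, and an empty sphere has mass 0
  as well. In each case the mass of the sphere is at most the geometric one. Two
  probability mass functions that are ordered pointwise are equal, hence such spheres do not occur.
\<close>

lemma map_pmf_distance_eq_geometric:
  fixes Q :: "'a::finite astring pmf"
  assumes Q: "\<And>s. pmf Q s = laplace_like_pf d lam \<rho> s"
    and sym: "\<And>s. d lam s = d s lam" and \<rho>: "\<rho> > 0"
  shows "map_pmf (\<lambda>s. d s lam) Q = geometric_pmf (1 / (\<rho> + 1))"
proof (rule pmf_eq_if_le)
  fix r
  define S where "S = dist_sphere d lam r"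
  define g where "g = 1 / (\<rho> + 1) * (\<rho> / (\<rho> + 1)) ^ r"
  have g: "pmf (geometric_pmf (1 / (\<rho> + 1))) r = g" "0 \<le> g"
    using \<rho> by (simp_all add: g_def field_simps)
  have pmfS: "pmf Q s = g / real (card S)" if "s \<in> S" for s
    using that sym by (auto simp: Q laplace_like_pf_def S_def dist_sphere_def g_def)
  have "(\<lambda>s. d s lam) -` {r} = S"
    by (auto simp: S_def dist_sphere_def sym)
  hence "pmf (map_pmf (\<lambda>s. d s lam) Q) r = measure_pmf.prob Q S"
    by (simp add: pmf_map)
  also have "\<dots> \<le> g"
  proof (cases "finite S \<and> S \<noteq> {}")
    case True
    thus ?thesis by (simp add: measure_measure_pmf_finite pmfS)
  next
    case False
    hence "card S = 0" by auto
    hence "S \<inter> set_pmf Q = {}" using pmfS by (auto simp: set_pmf_iff)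
    hence "measure_pmf.prob Q S = 0" by (simp add: measure_pmf_zero_iff Int_commute)
    thus ?thesis using g by simp
  qed
  finally show "pmf (map_pmf (\<lambda>s. d s lam) Q) r \<le> pmf (geometric_pmf (1 / (\<rho> + 1))) r"
    using g by simp
qed

lemma integrable_square_geometric_pmf:
  assumes "p \<in> {0<..1::real}"
  shows "integrable (geometric_pmf p) (\<lambda>n. (real n)\<^sup>2)"
proof (cases "p = 1")
  case False
  hence p: "0 < p" "p < 1" using assms by auto
  \<comment> \<open>Writing the power as an exponential makes the asymptotic comparison automatic.\<close>
  define c where "c = ln (1 - p)"
  have c: "c < 0" "exp c = 1 - p" using p by (auto simp: c_def)
  have "summable (\<lambda>n. real n ^ 2 * exp (c * real n))"
  proof (rule summable_comparison_test_bigo)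
    show "summable (\<lambda>n. norm (inverse (real n ^ 2)))"
      using inverse_power_summable[of 2, where ?'a=real] by (simp add: norm_inverse norm_power)
    show "(\<lambda>n. real n ^ 2 * exp (c * real n)) \<in> O(\<lambda>n. inverse (real n ^ 2))"
      using c by real_asymp
  qed
  hence "summable (\<lambda>n. real n ^ 2 * (1 - p) ^ n)"
    by (simp add: exp_of_nat2_mult c)
  hence "summable (\<lambda>n. p * (real n ^ 2 * (1 - p) ^ n))" by (rule summable_mult)
  thus ?thesis
    using p by (simp add: integrable_measure_pmf_finite measure_pmf_eq_density integrable_density
        integrable_count_space_nat_iff abs_mult mult_ac)
qed (simp add: integrable_measure_pmf_finite)

lemma prob_geometric_pmf_atLeast:
  assumes "p \<in> {0<..1::real}"
  shows "measure_pmf.prob (geometric_pmf p) {m..} = (1 - p) ^ m"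
proof -
  have "measure_pmf.prob (geometric_pmf p) {..<m} = (\<Sum>k<m. (1 - p) ^ k * p)"
    using assms by (simp add: measure_measure_pmf_finite)
  also have "\<dots> = 1 - (1 - p) ^ m"
    using assms by (simp add: sum_distrib_right[symmetric] one_diff_power_eq)
  finally show ?thesis
    using measure_pmf.prob_compl[of "{..<m}" "geometric_pmf p"] by (simp add: Compl_eq_Diff_UNIV[symmetric])
qed

section \<open>Pairwise independence and second moments\<close>

context prob_space
begin

lemma indep_var_count_spaceI:
  fixes X Y :: "'a \<Rightarrow> 'b"
  assumes count: "countable (UNIV :: 'b set)"
    and meas [measurable]: "X \<in> M \<rightarrow>\<^sub>M count_space UNIV" "Y \<in> M \<rightarrow>\<^sub>M count_space UNIV"
    and prod: "\<And>x y. prob {\<omega> \<in> space M. X \<omega> = x \<and> Y \<omega> = y}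
      = prob {\<omega> \<in> space M. X \<omega> = x} * prob {\<omega> \<in> space M. Y \<omega> = y}"
  shows "indep_var (count_space UNIV) X (count_space UNIV) Y"
  unfolding indep_var_distribution_eq
proof (intro conjI meas)
  let ?C = "count_space UNIV :: 'b measure"
  have pair: "?C \<Otimes>\<^sub>M ?C = count_space UNIV"
    using pair_measure_countable[OF count count] by simp
  have pair_sets: "sets (?C \<Otimes>\<^sub>M ?C) = UNIV"
    by (simp only: pair sets_count_space Pow_UNIV)
  interpret X: prob_space "distr M ?C X" by (rule prob_space_distr) measurable
  interpret Y: prob_space "distr M ?C Y" by (rule prob_space_distr) measurable
  have XY [measurable]: "(\<lambda>\<omega>. (X \<omega>, Y \<omega>)) \<in> M \<rightarrow>\<^sub>M ?C \<Otimes>\<^sub>M ?C" by measurable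
  have sets_eq: "sets (distr M ?C X \<Otimes>\<^sub>M distr M ?C Y) = UNIV"
    using sets_pair_measure_cong[of "distr M ?C X" ?C "distr M ?C Y" ?C]
    by (simp only: sets_distr pair_sets)
  show "distr M ?C X \<Otimes>\<^sub>M distr M ?C Y = distr M (?C \<Otimes>\<^sub>M ?C) (\<lambda>\<omega>. (X \<omega>, Y \<omega>))"
  proof (rule measure_eqI_countable[of _ UNIV])
    show "countable (UNIV :: ('b \<times> 'b) set)"
      using countable_SIGMA[OF count, of "\<lambda>_. UNIV"] count by simp
    fix p :: "'b \<times> 'b"
    obtain x y where p: "p = (x, y)" by (cases p)
    have "emeasure (distr M ?C X \<Otimes>\<^sub>M distr M ?C Y) ({x} \<times> {y})
        = emeasure (distr M ?C X) {x} * emeasure (distr M ?C Y) {y}"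
      by (rule Y.emeasure_pair_measure_Times) auto
    also have "\<dots> = ennreal (prob {\<omega> \<in> space M. X \<omega> = x} * prob {\<omega> \<in> space M. Y \<omega> = y})"
      by (simp add: emeasure_distr vimage_def Int_def conj_commute emeasure_eq_measure ennreal_mult)
    also have "\<dots> = emeasure (distr M (?C \<Otimes>\<^sub>M ?C) (\<lambda>\<omega>. (X \<omega>, Y \<omega>))) {p}"
      unfolding prod[symmetric]
      by (subst emeasure_distr[OF XY])
        (simp_all add: pair_sets p vimage_def Int_def conj_ac emeasure_eq_measure)
    finally show "emeasure (distr M ?C X \<Otimes>\<^sub>M distr M ?C Y) {p} = \<dots>"
      by (simp add: p)
  qed (use sets_eq in \<open>simp_all add: pair_sets\<close>)
qed

lemma indep_vars_imp_pairwise: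
  assumes indep: "indep_vars (\<lambda>_. count_space UNIV) X I" and ik: "i \<in> I" "k \<in> I" "i \<noteq> k"
    and count: "countable (UNIV :: 'b set)"
  shows "indep_var (count_space UNIV) (X i) (count_space UNIV) (X k :: 'a \<Rightarrow> 'b)"
proof (rule indep_var_count_spaceI[OF count])
  show "X i \<in> M \<rightarrow>\<^sub>M count_space UNIV" "X k \<in> M \<rightarrow>\<^sub>M count_space UNIV"
    using indep ik by (auto simp: indep_vars_def2)
  fix x y
  show "prob {\<omega> \<in> space M. X i \<omega> = x \<and> X k \<omega> = y}
      = prob {\<omega> \<in> space M. X i \<omega> = x} * prob {\<omega> \<in> space M. X k \<omega> = y}"
    using indep_varsD[OF indep, of "{i, k}" "\<lambda>l. if l = i then {x} else {y}"] ik
    by (simp add: vimage_def Int_def conj_ac)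
qed

text \<open>
  Independence is given for finite families of sites. It passes to whole strings because there are
  countably many of them and each is recognised by finitely many sites.
\<close>

lemma indep_random_strings_imp_pairwise:
  fixes \<sigma> :: "nat \<Rightarrow> 'a \<Rightarrow> 'b::finite astring"
  assumes rs: "\<And>i. random_string M (\<sigma> i)"
    and indep: "\<And>n. indep_random_strings M \<sigma> n" and ik: "i \<noteq> k"
  shows "indep_var (count_space UNIV) (\<sigma> i) (count_space UNIV) (\<sigma> k)"
proof (rule indep_var_count_spaceI[OF countable_astring])
  note [measurable] = random_string_measurable[OF rs]
  show "\<sigma> i \<in> M \<rightarrow>\<^sub>M count_space UNIV" "\<sigma> k \<in> M \<rightarrow>\<^sub>M count_space UNIV"
    by measurable
  fix s t :: "'b astring"
  define u where "u = (\<lambda>l. if l = i then s else t)"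
  define J where "J = (\<lambda>l. {..slen (u l)})"
  define A where "A = (\<lambda>l. {restrict (site (u l)) (J l)})"
  have ind: "indep_vars (\<lambda>i. PiM (J i) (\<lambda>_. count_space UNIV))
      (\<lambda>i \<omega>. \<lambda>j\<in>J i. site (\<sigma> i \<omega>) j) {..<Suc (max i k)}"
    using indep[of "Suc (max i k)"] unfolding indep_random_strings_def
    by (auto simp: J_def)
  have ev: "(\<lambda>\<omega>. \<lambda>j\<in>J l. site (\<sigma> l \<omega>) j) -` A l = {\<omega>. \<sigma> l \<omega> = u l}" for l
  proof -
    have "(\<lambda>j\<in>J l. site x j) = restrict (site (u l)) (J l) \<longleftrightarrow> x = u l" for x
      unfolding astring_eq_iff_initial J_def restrict_def fun_eq_iff by (metis atMost_iff)
    thus ?thesis by (auto simp: A_def)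
  qed
  have A: "A l \<in> sets (PiM (J l) (\<lambda>_. count_space UNIV))" for l
  proof -
    have "A l = (\<Pi>\<^sub>E j\<in>J l. {restrict (site (u l)) (J l) j})"
      unfolding A_def by (rule PiE_singleton[symmetric]) simp
    thus ?thesis by (simp add: J_def sets_PiM_I_finite)
  qed
  have "prob (\<Inter>l\<in>{i,k}. (\<lambda>\<omega>. \<lambda>j\<in>J l. site (\<sigma> l \<omega>) j) -` A l \<inter> space M)
      = (\<Prod>l\<in>{i,k}. prob ((\<lambda>\<omega>. \<lambda>j\<in>J l. site (\<sigma> l \<omega>) j) -` A l \<inter> space M))"
    by (rule indep_varsD[OF ind _ _ _ A]) auto
  thus "prob {\<omega> \<in> space M. \<sigma> i \<omega> = s \<and> \<sigma> k \<omega> = t}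
      = prob {\<omega> \<in> space M. \<sigma> i \<omega> = s} * prob {\<omega> \<in> space M. \<sigma> k \<omega> = t}"
    using ik by (simp add: ev u_def Int_def conj_ac)
qed

lemma nn_integral_centred_sum_square_le_of_law:
  fixes X :: "nat \<Rightarrow> 'a \<Rightarrow> 'b" and f :: "'b \<Rightarrow> real"
  assumes meas [measurable]: "\<And>i. X i \<in> M \<rightarrow>\<^sub>M count_space UNIV"
    and law: "\<And>i. distr M (count_space UNIV) (X i) = measure_pmf P"
    and indep: "\<And>i k. i \<noteq> k \<Longrightarrow> indep_var (count_space UNIV) (X i) (count_space UNIV) (X k)"
    and int: "integrable (measure_pmf P) f" and int2: "integrable (measure_pmf P) (\<lambda>x. (f x)\<^sup>2)"
  shows "(\<integral>\<^sup>+\<omega>. ennreal (((\<Sum>i<n. f (X i \<omega>)) - real n * measure_pmf.expectation P f)\<^sup>2) \<partial>M)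
    \<le> ennreal (measure_pmf.variance P f * real n)"
proof (rule nn_integral_centred_sum_square_le)
  have distr: "integrable M (\<lambda>\<omega>. g (X i \<omega>)) \<longleftrightarrow> integrable (measure_pmf P) g"
    "expectation (\<lambda>\<omega>. g (X i \<omega>)) = measure_pmf.expectation P g" for g :: "'b \<Rightarrow> real" and i
    by (auto simp: law[of i, symmetric] integrable_distr_eq integral_distr)
  show "integrable M (\<lambda>\<omega>. f (X i \<omega>))" for i using distr int by simp
  show mean: "expectation (\<lambda>\<omega>. f (X i \<omega>)) = measure_pmf.expectation P f" for i using distr by simp
  show "integrable M (\<lambda>\<omega>. (f (X i \<omega>))\<^sup>2)" for i
    using distr(1)[of "\<lambda>x. (f x)\<^sup>2"] int2 by simp
  show "variance (\<lambda>\<omega>. f (X i \<omega>)) \<le> measure_pmf.variance P f" for i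
    using distr(2)[of "\<lambda>x. (f x - measure_pmf.expectation P f)\<^sup>2"] mean by simp
  show "indep_var borel (\<lambda>\<omega>. f (X i \<omega>)) borel (\<lambda>\<omega>. f (X k \<omega>))" if "i \<noteq> k" for i k
    using indep_var_compose[OF indep[OF that], of f borel f borel] by (simp add: comp_def)
qed

lemma AE_averages_tendsto_expectation:
  fixes X :: "nat \<Rightarrow> 'a \<Rightarrow> 'b" and f :: "'b \<Rightarrow> real"
  assumes meas [measurable]: "\<And>i. X i \<in> M \<rightarrow>\<^sub>M count_space UNIV"
    and law: "\<And>i. distr M (count_space UNIV) (X i) = measure_pmf P"
    and indep: "\<And>i k. i \<noteq> k \<Longrightarrow> indep_var (count_space UNIV) (X i) (count_space UNIV) (X k)"
    and int: "integrable (measure_pmf P) f" and int2: "integrable (measure_pmf P) (\<lambda>x. (f x)\<^sup>2)"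
    and nonneg: "\<And>x. 0 \<le> f x"
  shows "AE \<omega> in M. (\<lambda>n. (1 / real n) * (\<Sum>i<n. f (X i \<omega>))) \<longlonglongrightarrow> measure_pmf.expectation P f"
  by (rule AE_averages_tendsto_if_variance_linear
      [OF _ nonneg _ nn_integral_centred_sum_square_le_of_law[OF meas law indep int int2]])
    (auto intro: measurable_compose[OF meas] integral_nonneg_AE)

end

lemma geometric_mean_and_square:
  assumes D: "map_pmf D Q = geometric_pmf (1 / (\<rho> + 1))" and \<rho>: "\<rho> > 0"
  shows "integrable (measure_pmf Q) (\<lambda>s. real (D s))"
    and "integrable (measure_pmf Q) (\<lambda>s. (real (D s))\<^sup>2)"
    and "measure_pmf.expectation Q (\<lambda>s. real (D s)) = \<rho>"
proof -
  have p: "1 / (\<rho> + 1) \<in> {0<..1}" using \<rho> by (auto simp: field_simps)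
  show "integrable (measure_pmf Q) (\<lambda>s. real (D s))"
    using integrable_real_geometric_pmf[OF p]
    by (simp add: D[symmetric] map_pmf_rep_eq integrable_distr_eq)
  show "integrable (measure_pmf Q) (\<lambda>s. (real (D s))\<^sup>2)"
    using integrable_square_geometric_pmf[OF p]
    by (simp add: D[symmetric] map_pmf_rep_eq integrable_distr_eq)
  have "measure_pmf.expectation Q (\<lambda>s. real (D s)) = measure_pmf.expectation (map_pmf D Q) real"
    by simp
  also have "\<dots> = \<rho>"
    unfolding D expectation_geometric_pmf[OF p] using \<rho> by (simp add: field_simps)
  finally show "measure_pmf.expectation Q (\<lambda>s. real (D s)) = \<rho>" .
qed

section \<open>Known centre and independent strings\<close>

lemma AE_mean_distance_tendsto_if_strings_indep:
  fixes \<sigma> :: "nat \<Rightarrow> 'w \<Rightarrow> 'a::finite astring"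
  assumes "prob_space M" and rs: "\<And>i. random_string M (\<sigma> i)" and \<rho>: "\<rho> > 0"
    and d: "d \<in> distance_functions"
    and law: "\<And>i. laplace_like_distributed M (\<sigma> i) d lam \<rho>"
    and indep: "\<And>n. indep_random_strings M \<sigma> n"
  shows "AE \<omega> in M. (\<lambda>n. (1 / real n) * (\<Sum>i<n. real (d (\<sigma> i \<omega>) lam))) \<longlonglongrightarrow> \<rho>"
proof -
  interpret prob_space M by fact
  obtain Q where Q: "\<And>s. pmf Q s = laplace_like_pf d lam \<rho> s"
    "\<And>i. distr M (count_space UNIV) (\<sigma> i) = measure_pmf Q"
    using common_law_pmf[where \<sigma> = \<sigma>, OF \<open>prob_space M\<close> rs law] by metis
  have sym: "d lam s = d s lam" for s
    using d Metric_space.commute[of UNIV "\<lambda>s t. real (d s t)" lam s]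
    by (simp add: distance_functions_def)
  note geo = geometric_mean_and_square[OF map_pmf_distance_eq_geometric[where d = d, OF Q(1) sym \<rho>] \<rho>]
  show ?thesis
    using AE_averages_tendsto_expectation[OF random_string_measurable[OF rs] Q(2)
        indep_random_strings_imp_pairwise[OF rs indep] geo(1,2)]
    by (simp add: geo(3))
qed

section \<open>Site probabilities under the extended Hamming distance\<close>

lemma ext_hamming_commute: "ext_hamming s t = ext_hamming t s"
  by (simp add: ext_hamming_def eq_commute)

lemma finite_differing_sites: "finite {j. site s j \<noteq> site t j}"
proof (rule finite_subset)
  show "{j. site s j \<noteq> site t j} \<subseteq> {..<max (slen s) (slen t)}"
  proof
    fix j assume "j \<in> {j. site s j \<noteq> site t j}"
    hence "site s j \<noteq> None \<or> site t j \<noteq> None" by auto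
    thus "j \<in> {..<max (slen s) (slen t)}" by (auto simp: site_eq_None_iff simp del: not_None_eq)
  qed
qed simp

lemma ext_hamming_eq_0_iff: "ext_hamming s t = 0 \<longleftrightarrow> s = t"
  by (auto simp: ext_hamming_def finite_differing_sites intro: astring_eqI)

lemma le_ext_hamming_if_site:
  assumes "slen lam \<le> j" "site s j \<noteq> None"
  shows "Suc j - slen lam \<le> ext_hamming s lam"
proof -
  have "{slen lam..j} \<subseteq> {i. site s i \<noteq> site lam i}"
    using assms site_None_mono[of s _ j] by (auto simp: site_eq_None_iff[of lam, THEN iffD2])
  from card_mono[OF finite_differing_sites this] show ?thesis
    by (simp add: ext_hamming_def)
qed

lemma ex_other_element:
  assumes "CARD('a::finite) \<ge> 2"
  shows "\<exists>b. b \<noteq> (a :: 'a)"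
proof (rule ccontr)
  assume "\<nexists>b. b \<noteq> a"
  hence "UNIV = {a}" by auto
  hence "CARD('a) = card {a}" by (rule arg_cong)
  thus False using assms by simp
qed

text \<open>
  The form in which probabilities of events are compared below: the mass of a string depends only on
  its distance to the centre, so distance preserving injections preserve probabilities.
\<close>

lemma prob_image_eq:
  assumes inj: "inj_on \<phi> A" and pres: "\<And>s. s \<in> A \<Longrightarrow> pmf Q (\<phi> s) = pmf Q s"
  shows "measure_pmf.prob Q (\<phi> ` A) = measure_pmf.prob Q A"
proof -
  have "emeasure (measure_pmf Q) (\<phi> ` A) = (\<integral>\<^sup>+s. ennreal (pmf Q (\<phi> s)) \<partial>count_space A)"
    by (rule nn_integral_pmf'[symmetric, OF inj])
  also have "\<dots> = emeasure (measure_pmf Q) A"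
    unfolding nn_integral_pmf[symmetric] by (intro nn_integral_cong) (simp add: pres)
  finally show ?thesis
    by (simp add: measure_pmf.emeasure_eq_measure)
qed

context
  fixes Q :: "'a::finite astring pmf" and lam :: "'a astring" and \<rho> :: real
  assumes Q: "\<And>s. pmf Q s = laplace_like_pf ext_hamming lam \<rho> s" and \<rho>: "\<rho> > 0"
begin

lemma pmf_eq_if_same_distance: "ext_hamming s lam = ext_hamming t lam \<Longrightarrow> pmf Q s = pmf Q t"
  by (simp add: Q laplace_like_pf_def)

lemma pmf_centre_pos: "pmf Q lam > 0"
proof -
  have "ext_hamming lam lam = 0" by (simp add: ext_hamming_eq_0_iff)
  moreover have "dist_sphere ext_hamming lam 0 = {lam}"
    by (auto simp: dist_sphere_def ext_hamming_eq_0_iff)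
  ultimately show ?thesis
    using \<rho> by (simp add: Q laplace_like_pf_def)
qed

text \<open>
  Replacing \<open>a\<close> by \<open>b\<close> at a site where the centre is empty keeps the mismatch there, hence the
  distance.
\<close>

lemma prob_letter_le_beyond_centre:
  assumes j: "slen lam \<le> j"
  shows "measure_pmf.prob Q {t. site t j = Some a} \<le> measure_pmf.prob Q {t. site t j = Some b}"
proof -
  define \<phi> where "\<phi> = (\<lambda>t :: 'a astring. prefix_astring ((site t)(j := Some b)) (slen t))"
  define A where "A = {t. site t j = Some a}"
  have \<phi>: "site (\<phi> t) = (site t)(j := Some b)" if "t \<in> A" for t
  proof
    fix i
    have "site t i \<noteq> None" if "i < slen t" for i
      using that site_eq_None_iff[of t i] by simp
    moreover have "j < slen t"
      using \<open>t \<in> A\<close> site_eq_None_iff[of t j] by (simp add: A_def)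
    moreover have "site t i = None" if "\<not> i < slen t"
      using that site_eq_None_iff[of t i] by simp
    ultimately show "site (\<phi> t) i = ((site t)(j := Some b)) i"
      by (subst \<phi>_def, subst site_prefix_astring) auto
  qed
  have "inj_on \<phi> A"
  proof (rule inj_onI)
    fix t u assume tu: "t \<in> A" "u \<in> A" "\<phi> t = \<phi> u"
    show "t = u"
    proof (rule astring_eqI)
      fix i
      have "((site t)(j := Some b)) i = ((site u)(j := Some b)) i"
        using \<phi>[OF tu(1)] \<phi>[OF tu(2)] tu(3) by simp
      thus "site t i = site u i"
        using tu by (cases "i = j") (auto simp: A_def)
    qed
  qed
  moreover have "pmf Q (\<phi> t) = pmf Q t" if "t \<in> A" for t
  proof (rule pmf_eq_if_same_distance)
    have "site lam j = None" using j by (simp add: site_eq_None_iff)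
    hence "{i. site (\<phi> t) i \<noteq> site lam i} = {i. site t i \<noteq> site lam i}"
      using that by (auto simp: \<phi> A_def)
    thus "ext_hamming (\<phi> t) lam = ext_hamming t lam" by (simp add: ext_hamming_def)
  qed
  ultimately have "measure_pmf.prob Q A = measure_pmf.prob Q (\<phi> ` A)"
    by (rule prob_image_eq[symmetric])
  also have "\<dots> \<le> measure_pmf.prob Q {t. site t j = Some b}"
    by (rule measure_pmf.finite_measure_mono) (auto simp: \<phi>)
  finally show ?thesis by (simp add: A_def)
qed

lemma prob_letter_eq_beyond_centre:
  assumes "slen lam \<le> j"
  shows "measure_pmf.prob Q {t. site t j = Some a} = measure_pmf.prob Q {t. site t j = Some b}"
  by (intro antisym prob_letter_le_beyond_centre assms)

text \<open>
  The injection \<open>\<phi>\<close> from the strings with entry \<open>x\<close> at site \<open>j\<close> repairs the mismatch at \<open>j\<close>, extends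
  a string shorter than the centre by the missing part of the centre, and then appends as
  many letters beyond the end of the centre as mismatches were lost. The appended letter is \<open>b1\<close>
  if the original string was shorter than the centre and \<open>b2\<close> otherwise; this and the length of
  the image determine the length of the original, and so \<open>\<phi>\<close> can be inverted. Since
  at least one letter is appended, \<open>\<phi>\<close> misses the centre, which has positive mass; therefore
  the inequality is strict.
\<close>

lemma centre_letter_strict_mode:
  assumes card: "CARD('a) \<ge> 2" and j: "j < slen lam" and x: "x \<noteq> site lam j"
  shows "measure_pmf.prob Q {t. site t j = x} < measure_pmf.prob Q {t. site t j = site lam j}"
proof -
  define l where "l = slen lam"
  obtain b1 b2 :: 'a where b: "b1 \<noteq> b2"
    using ex_other_element[OF card] by blast
  define A where "A = {t. site t j = x}"
  \<comment> \<open>If \<open>x\<close> is a letter, repairing site \<open>j\<close> loses a mismatch that is not counted in \<open>l - slen t\<close>.\<close>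
  define e where "e = (if x = None then 0 else 1 :: nat)"
  define L where "L = (\<lambda>t :: 'a astring. max (slen t) l + (l - slen t) + e)"
  define c where "c = (\<lambda>t :: 'a astring. if slen t < l then b1 else b2)"
  define y where "y = (\<lambda>t i. if i = j then site lam j else if i < slen t then site t i
    else if i < l then site lam i else Some (c t))"
  define \<phi> where "\<phi> = (\<lambda>t. prefix_astring (y t) (L t))"
  have jl: "j < l" using j by (simp add: l_def)
  have jt: "j < slen t \<longleftrightarrow> e = 1" "slen t \<le> j \<longleftrightarrow> e = 0" if "t \<in> A" for t
    using that site_eq_None_iff[of t j] by (auto simp: A_def e_def)
  have y: "y t i \<noteq> None" for t i
    using site_eq_None_iff[of t i] site_eq_None_iff[of lam i] site_eq_None_iff[of lam j] jl
    by (auto simp: y_def l_def)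
  have \<phi>: "site (\<phi> t) i = (if i < L t then y t i else None)" for t i
    unfolding \<phi>_def by (rule site_prefix_astring) (rule y)
  have slen\<phi>: "slen (\<phi> t) = L t" for t
    unfolding \<phi>_def by (rule slen_prefix_astring) (rule y)
  have L_gt: "max (slen t) l < L t" if "t \<in> A" for t
    using jt[OF that] jl by (auto simp: L_def e_def split: if_splits)
  have last: "site (\<phi> t) (L t - 1) = Some (c t)" if "t \<in> A" for t
    using L_gt[OF that] jl by (auto simp: \<phi> y_def)
  have inj: "inj_on \<phi> A"
  proof (rule inj_onI)
    fix t u assume tu: "t \<in> A" "u \<in> A" and eq: "\<phi> t = \<phi> u"
    have L: "L t = L u" using eq slen\<phi>[of t] slen\<phi>[of u] by simp
    have "c t = c u" using last[OF tu(1)] last[OF tu(2)] eq L by simp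
    hence "slen t < l \<longleftrightarrow> slen u < l" using b by (auto simp: c_def split: if_splits)
    hence len: "slen t = slen u" using L by (auto simp: L_def max_def split: if_splits)
    show "t = u"
    proof (rule astring_eqI)
      fix i
      show "site t i = site u i"
      proof (cases "i = j \<or> slen t \<le> i")
        case True
        thus ?thesis
          using tu len site_eq_None_iff[of t i] site_eq_None_iff[of u i] by (auto simp: A_def)
      next
        case False
        hence "i < L t" "i < L u" using L_gt[OF tu(1)] L by auto
        thus ?thesis
          using False len \<phi>[of t i] \<phi>[of u i] eq by (simp add: y_def)
      qed
    qed
  qed
  have dist: "ext_hamming (\<phi> t) lam = ext_hamming t lam" if t: "t \<in> A" for t
  proof -
    define B where "B = {i. i < min (slen t) l \<and> i \<noteq> j \<and> site t i \<noteq> site lam i}"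
    have fin: "finite B" by (simp add: B_def)
    have lamN: "site lam i = None \<longleftrightarrow> l \<le> i" for i by (simp add: site_eq_None_iff l_def)
    have tN: "site t i = None \<longleftrightarrow> slen t \<le> i" for i by (simp add: site_eq_None_iff)
    \<comment> \<open>Both distances are \<open>card B\<close>, the mismatches that \<open>\<phi>\<close> leaves alone, plus explicit sets.\<close>
    have "{i. site t i \<noteq> site lam i}
        = B \<union> {slen t..<l} \<union> {l..<slen t} \<union> (if e = 0 then {} else {j})"
    proof (rule set_eqI)
      fix i
      show "i \<in> {i. site t i \<noteq> site lam i} \<longleftrightarrow>
        i \<in> B \<union> {slen t..<l} \<union> {l..<slen t} \<union> (if e = 0 then {} else {j})"
        using t jt[OF t] jl x lamN[of i] tN[of i]
        by (cases "i < slen t"; cases "i < l"; cases "i = j") (auto simp: B_def A_def e_def split: if_splits)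
    qed
    hence "ext_hamming t lam
        = card (B \<union> {slen t..<l} \<union> {l..<slen t} \<union> (if e = 0 then {} else {j}))"
      by (simp add: ext_hamming_def)
    also have "\<dots> = card B + (l - slen t) + (slen t - l) + e"
      using fin jt[OF t] jl
      by (subst card_Un_disjoint, simp, simp, force simp: B_def e_def)+ (simp add: e_def)
    also have "\<dots> = card B + (L t - l)" by (simp add: L_def max_def)
    also have "\<dots> = card (B \<union> {l..<L t})"
      using fin by (subst card_Un_disjoint) (auto simp: B_def)
    also have "B \<union> {l..<L t} = {i. site (\<phi> t) i \<noteq> site lam i}"
    proof (rule set_eqI)
      fix i
      show "i \<in> B \<union> {l..<L t} \<longleftrightarrow> i \<in> {i. site (\<phi> t) i \<noteq> site lam i}"
        using L_gt[OF t] jl lamN[of i] tN[of i]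
        by (cases "i < slen t"; cases "i < l"; cases "i = j"; cases "i < L t")
          (auto simp: B_def \<phi> y_def)
    qed
    finally show ?thesis by (simp add: ext_hamming_def)
  qed
  have lam_notin: "lam \<notin> \<phi> ` A"
  proof
    assume "lam \<in> \<phi> ` A"
    then obtain t where t: "t \<in> A" "lam = \<phi> t" by auto
    thus False using L_gt[OF t(1)] slen\<phi>[of t] by (simp add: l_def)
  qed
  have "measure_pmf.prob Q A = measure_pmf.prob Q (\<phi> ` A)"
    by (rule prob_image_eq[symmetric, OF inj]) (rule pmf_eq_if_same_distance[OF dist])
  also have "\<dots> < measure_pmf.prob Q (\<phi> ` A) + measure_pmf.prob Q {lam}"
    using pmf_centre_pos by (simp add: measure_pmf_single)
  also have "\<dots> = measure_pmf.prob Q (\<phi> ` A \<union> {lam})"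
    using lam_notin by (subst measure_pmf.finite_measure_Union) auto
  also have "\<dots> \<le> measure_pmf.prob Q {t. site t j = site lam j}"
  proof (rule measure_pmf.finite_measure_mono)
    have "site (\<phi> t) j = site lam j" if "t \<in> A" for t
      using L_gt[OF that] jl by (simp add: \<phi> y_def)
    thus "\<phi> ` A \<union> {lam} \<subseteq> {t. site t j = site lam j}" by auto
  qed simp
  finally show ?thesis by (simp add: A_def)
qed

text \<open>
  A letter at site \<open>j\<close> beyond the end of the centre forces letters, hence mismatches, at all sites
  from \<open>slen lam\<close> to \<open>j\<close>, and the geometric law has an exponential tail.
\<close>

lemma prob_beyond_centre_le:
  assumes "slen lam \<le> j"
  shows "measure_pmf.prob Q {t. site t j \<noteq> None} \<le> (\<rho> / (\<rho> + 1)) ^ (Suc j - slen lam)"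
proof -
  have p: "1 / (\<rho> + 1) \<in> {0<..1}" using \<rho> by (auto simp: field_simps)
  have "measure_pmf.prob Q {t. site t j \<noteq> None}
      \<le> measure_pmf.prob Q ((\<lambda>s. ext_hamming s lam) -` {Suc j - slen lam..})"
    using le_ext_hamming_if_site[OF assms] by (intro measure_pmf.finite_measure_mono) auto
  also have "\<dots> = measure_pmf.prob (map_pmf (\<lambda>s. ext_hamming s lam) Q) {Suc j - slen lam..}"
    by simp
  also have "map_pmf (\<lambda>s. ext_hamming s lam) Q = geometric_pmf (1 / (\<rho> + 1))"
    by (rule map_pmf_distance_eq_geometric[OF Q ext_hamming_commute \<rho>])
  also have "measure_pmf.prob \<dots> {Suc j - slen lam..} = (1 - 1 / (\<rho> + 1)) ^ (Suc j - slen lam)"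
    by (rule prob_geometric_pmf_atLeast[OF p])
  also have "1 - 1 / (\<rho> + 1) = \<rho> / (\<rho> + 1)" using \<rho> by (simp add: field_simps)
  finally show ?thesis .
qed

end

section \<open>Recovery of the centre by the truncated consensus sequence\<close>

lemma Max_Min_range_tendsto:
  fixes f :: "nat \<Rightarrow> 'b::finite \<Rightarrow> real"
  assumes "\<And>x. (\<lambda>n. f n x) \<longlonglongrightarrow> p x"
  shows "(\<lambda>n. Max (range (f n))) \<longlonglongrightarrow> Max (range p)"
    and "(\<lambda>n. Min (range (f n))) \<longlonglongrightarrow> Min (range p)"
proof -
  have bound: "\<forall>\<^sub>F n in sequentially. \<forall>x. \<bar>f n x - p x\<bar> < r" if "r > 0" for r
    using assms[THEN tendstoD, OF that] unfolding dist_real_def by (subst eventually_all_finite)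
      (auto simp: dist_real_def)
  show "(\<lambda>n. Max (range (f n))) \<longlonglongrightarrow> Max (range p)"
  proof (rule tendstoI)
    fix r :: real assume "r > 0"
    from bound[OF this] show "\<forall>\<^sub>F n in sequentially. dist (Max (range (f n))) (Max (range p)) < r"
    proof eventually_elim
      case (elim n)
      have "Max (range (f n)) \<in> range (f n)" "Max (range p) \<in> range p"
        by (intro Max_in; simp)+
      then obtain x y where xy: "Max (range (f n)) = f n x" "Max (range p) = p y"
        by (metis imageE)
      have "f n y \<le> f n x" "p x \<le> p y"
        unfolding xy[symmetric] by simp_all
      thus ?case using elim[rule_format, of x] elim[rule_format, of y]
        unfolding xy dist_real_def by linarith
    qed
  qed
  show "(\<lambda>n. Min (range (f n))) \<longlonglongrightarrow> Min (range p)"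
  proof (rule tendstoI)
    fix r :: real assume "r > 0"
    from bound[OF this] show "\<forall>\<^sub>F n in sequentially. dist (Min (range (f n))) (Min (range p)) < r"
    proof eventually_elim
      case (elim n)
      have "Min (range (f n)) \<in> range (f n)" "Min (range p) \<in> range p"
        by (intro Min_in; simp)+
      then obtain x y where xy: "Min (range (f n)) = f n x" "Min (range p) = p y"
        by (metis imageE)
      have "f n x \<le> f n y" "p y \<le> p x"
        unfolding xy[symmetric] by simp_all
      thus ?case using elim[rule_format, of x] elim[rule_format, of y]
        unfolding xy dist_real_def by linarith
    qed
  qed
qed

text \<open>
  Condition U asks for near-uniformity on a final segment of the sites below \<open>j_star\<close>. As it fails
  at the last site of \<open>lam\<close>, such a segment cannot start inside \<open>lam\<close>. So either
  \<open>j_star\<close> is the length of \<open>lam\<close> and U fails, or U holds and \<open>j_trunc\<close> is that length.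
\<close>

lemma trunc_consensus_eqI:
  fixes ss :: "'a::finite astring list" and lam :: "'a astring"
  assumes star: "slen lam \<le> j_star ss"
    and unif: "\<And>j. slen lam \<le> j \<Longrightarrow> j < j_star ss \<Longrightarrow>
      Max (range (\<lambda>a. rel_freq ss j (Some a))) - Min (range (\<lambda>a. rel_freq ss j (Some a))) < \<epsilon>"
    and last: "\<And>k. slen lam = Suc k \<Longrightarrow>
      \<not> Max (range (\<lambda>a. rel_freq ss k (Some a))) - Min (range (\<lambda>a. rel_freq ss k (Some a))) < \<epsilon>"
    and mode: "\<And>j. j < slen lam \<Longrightarrow> \<eta> ss j = site lam j"
  shows "trunc_consensus \<eta> \<epsilon> ss = lam"
proof -
  define l where "l = slen lam"
  have from_l: "uniform_from \<epsilon> ss l"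
    using unif by (auto simp: uniform_from_def l_def)
  have below: "\<not> uniform_from \<epsilon> ss j" if "j < l" for j
  proof -
    obtain k where k: "l = Suc k" using \<open>j < l\<close> by (cases l) auto
    have "k \<in> {j..<j_star ss}" using that star k by (auto simp: l_def)
    thus ?thesis using last[of k] k unfolding uniform_from_def l_def by blast
  qed
  have "l = j_star ss \<and> \<not> cond_U \<epsilon> ss \<or> l < j_star ss \<and> cond_U \<epsilon> ss \<and> j_trunc \<epsilon> ss = l"
  proof (cases "l = j_star ss")
    case True
    thus ?thesis using below by (auto simp: cond_U_def)
  next
    case False
    hence less: "l < j_star ss" using star by (simp add: l_def)
    hence "j_trunc \<epsilon> ss = l"
      unfolding j_trunc_def using from_l below
      by (intro Least_equality) (auto simp: not_less[symmetric])
    thus ?thesis using less from_l by (auto simp: cond_U_def)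
  qed
  moreover have "prefix_astring (\<eta> ss) l = lam"
    unfolding l_def by (rule prefix_astring_eq) (rule mode)
  moreover have "empty_astring = lam" if "l = 0"
    using that by (intro empty_astring_eq) (simp add: l_def)
  ultimately show ?thesis
    by (auto simp: trunc_consensus_def)
qed

text \<open>
  Ties between the empty letter and others may persist in the limit at sites from \<open>slen lam\<close> on, so
  \<open>j_star\<close> need not converge. It is eventually trapped between \<open>slen lam\<close>, below which the empty
  letter is not a mode, and \<open>J\<close>, where it is the strict mode, and this is enough: the finitely many
  sites in between all satisfy the near-uniformity condition from some \<open>n\<close> on.
\<close>

lemma eventually_trunc_consensus_eq:
  fixes s :: "nat \<Rightarrow> 'a::finite astring" and lam :: "'a astring"
  assumes freq: "\<And>j x. (\<lambda>n. rel_freq (map s [0..<n]) j x) \<longlonglongrightarrow> p j x"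
    and card: "CARD('a) \<ge> 2"
    and inside: "\<And>j x. j < slen lam \<Longrightarrow> x \<noteq> site lam j \<Longrightarrow> p j x < p j (site lam j)"
    and beyond: "\<And>j a b. slen lam \<le> j \<Longrightarrow> p j (Some a) = p j (Some b)"
    and far: "slen lam \<le> J" "\<And>a. p J (Some a) < p J None"
    and \<eta>: "mode_rule \<eta>"
  shows "\<forall>\<^sub>F \<epsilon> in at_right 0. \<forall>\<^sub>F n in sequentially. trunc_consensus \<eta> \<epsilon> (map s [0..<n]) = lam"
proof -
  define S where "S = (\<lambda>n. map s [0..<n])"
  define l where "l = slen lam"
  define spread where "spread = (\<lambda>n j. Max (range (\<lambda>a. rel_freq (S n) j (Some a)))
    - Min (range (\<lambda>a. rel_freq (S n) j (Some a))))"
  define sp where "sp = (\<lambda>j. Max (range (\<lambda>a. p j (Some a))) - Min (range (\<lambda>a. p j (Some a))))"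
  have freq': "(\<lambda>n. rel_freq (S n) j x) \<longlonglongrightarrow> p j x" for j x
    using freq by (simp add: S_def)
  have spread: "(\<lambda>n. spread n j) \<longlonglongrightarrow> sp j" for j
    unfolding spread_def sp_def by (intro tendsto_diff Max_Min_range_tendsto freq')
  have sp_beyond: "sp j = 0" if "l \<le> j" for j
  proof -
    have "range (\<lambda>a. p j (Some a)) = {p j (Some undefined)}"
      using that beyond[of j _ undefined] by (auto simp: l_def)
    thus ?thesis unfolding sp_def by simp
  qed
  have sp_last: "sp k > 0" if "l = Suc k" for k
  proof -
    have "site lam k \<noteq> None" using that by (simp add: site_eq_None_iff l_def del: not_None_eq)
    then obtain a where a: "site lam k = Some a" by auto
    obtain b where b: "b \<noteq> a"
      using ex_other_element[OF card] by blast
    have "p k (Some b) < p k (Some a)"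
      using inside[of k "Some b"] that a b by (simp add: l_def)
    moreover have "p k (Some a) \<le> Max (range (\<lambda>a. p k (Some a)))" by simp
    moreover have "Min (range (\<lambda>a. p k (Some a))) \<le> p k (Some b)" by simp
    ultimately show ?thesis unfolding sp_def by linarith
  qed
  have ev_less: "\<forall>\<^sub>F n in sequentially. rel_freq (S n) j x < rel_freq (S n) j y"
    if "p j x < p j y" for j x y
    using order_tendstoD(1)[OF tendsto_diff[OF freq'[of j y] freq'[of j x]], of 0] that by simp
  have ev_inside: "\<forall>\<^sub>F n in sequentially. \<forall>j\<in>{..<l}. \<forall>x\<in>-{site lam j}.
      rel_freq (S n) j x < rel_freq (S n) j (site lam j)"
    using inside ev_less by (intro eventually_ball_finite ballI) (auto simp: l_def)
  have ev_far: "\<forall>\<^sub>F n in sequentially. \<forall>a\<in>UNIV. rel_freq (S n) J (Some a) < rel_freq (S n) J None"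
    using far ev_less by (intro eventually_ball_finite ballI) auto
  have ev: "\<forall>\<^sub>F n in sequentially. trunc_consensus \<eta> \<epsilon> (S n) = lam"
    if \<epsilon>: "0 < \<epsilon>" "\<And>k. l = Suc k \<Longrightarrow> \<epsilon> < sp k" for \<epsilon>
  proof -
    have ev_unif: "\<forall>\<^sub>F n in sequentially. \<forall>j\<in>{l..<J}. spread n j < \<epsilon>"
      using order_tendstoD(2)[OF spread] \<epsilon> sp_beyond by (intro eventually_ball_finite ballI) auto
    have ev_last: "\<forall>\<^sub>F n in sequentially. \<forall>k\<in>{k. l = Suc k}. \<epsilon> < spread n k"
      using order_tendstoD(1)[OF spread] \<epsilon> by (intro eventually_ball_finite ballI) (auto intro: finite_subset[of _ "{..l}"])
    show ?thesis using ev_inside ev_far ev_unif ev_last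
    proof eventually_elim
      case (elim n)
      let ?None_max = "\<lambda>j. rel_freq (S n) j None = Max (range (rel_freq (S n) j))"
      have "rel_freq (S n) J x \<le> rel_freq (S n) J None" for x
        using elim(2) by (cases x) (auto intro: less_imp_le)
      hence "?None_max J"
        by (intro Max_eqI[symmetric]) auto
      hence J: "j_star (S n) \<le> J" "?None_max (j_star (S n))"
        unfolding j_star_def by (rule Least_le, rule LeastI)
      have strict: "rel_freq (S n) j x < rel_freq (S n) j (site lam j)" if "j < l" "x \<noteq> site lam j" for j x
        using elim(1) that by auto
      have l: "l \<le> j_star (S n)"
      proof (rule ccontr)
        assume "\<not> l \<le> j_star (S n)"
        hence less: "j_star (S n) < l" by simp
        hence "None \<noteq> site lam (j_star (S n))"
          using site_eq_None_iff[of lam "j_star (S n)"] by (auto simp: l_def)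
        from strict[OF less this] have "\<not> ?None_max (j_star (S n))"
          by (auto simp: not_le[symmetric])
        thus False using J by simp
      qed
      have mode: "\<eta> (S n) j = site lam j" if "j < l" for j
        using \<eta> strict[OF that] unfolding mode_rule_def is_arg_max_def by auto
      show ?case
        by (rule trunc_consensus_eqI)
          (use l J elim(3,4) mode in \<open>auto simp: l_def spread_def not_less intro: less_imp_le\<close>)
    qed
  qed
  \<comment> \<open>The threshold for \<open>\<epsilon>\<close> is the limiting spread at the last site of \<open>lam\<close>, if there is one.\<close>
  define \<delta> where "\<delta> = (if l = 0 then 1 else sp (l - 1))"
  have "\<delta> > 0" using sp_last[of "l - 1"] by (auto simp: \<delta>_def)
  hence "\<forall>\<^sub>F \<epsilon> in at_right 0. \<epsilon> \<in> {0<..<\<delta>}"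
    by (rule eventually_at_right_real)
  thus ?thesis
  proof eventually_elim
    case (elim \<epsilon>)
    hence "\<epsilon> < sp k" if "l = Suc k" for k using that by (simp add: \<delta>_def)
    with elim have "\<forall>\<^sub>F n in sequentially. trunc_consensus \<eta> \<epsilon> (S n) = lam" by (intro ev) auto
    thus ?case by (simp add: S_def)
  qed
qed

section \<open>Second moments of series of dependent terms\<close>

text \<open>
  Cauchy-Schwarz for \<open>sqrt (w j)\<close> and \<open>T j / sqrt (w j)\<close>. It bounds the square of a series of
  dependent terms by a series of their squares, which can be integrated term by term.
\<close>

lemma square_suminf_le_weighted:
  fixes T w :: "nat \<Rightarrow> real"
  assumes T: "T sums t" and w: "w sums W" and w_pos: "\<And>j. w j > 0"
  shows "ennreal (t\<^sup>2) \<le> ennreal W * (\<Sum>j. ennreal ((T j)\<^sup>2 / w j))"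
proof (rule LIMSEQ_le_const2)
  show "(\<lambda>N. ennreal ((\<Sum>j<N. T j)\<^sup>2)) \<longlonglongrightarrow> ennreal (t\<^sup>2)"
    using T by (intro tendsto_ennrealI tendsto_power) (simp add: sums_def)
  show "\<exists>N0. \<forall>N\<ge>N0. ennreal ((\<Sum>j<N. T j)\<^sup>2) \<le> ennreal W * (\<Sum>j. ennreal ((T j)\<^sup>2 / w j))"
  proof (intro exI allI impI)
    fix N :: nat
    have "(\<Sum>j<N. T j)\<^sup>2 = (\<Sum>j<N. sqrt (w j) * (T j / sqrt (w j)))\<^sup>2"
      using w_pos by (intro arg_cong[of _ _ "\<lambda>x. x\<^sup>2"] sum.cong) (simp_all add: less_imp_neq[symmetric])
    also have "\<dots> \<le> (\<Sum>j<N. (sqrt (w j))\<^sup>2) * (\<Sum>j<N. (T j / sqrt (w j))\<^sup>2)"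
      by (rule Cauchy_Schwarz_ineq_sum)
    also have "\<dots> = (\<Sum>j<N. w j) * (\<Sum>j<N. (T j)\<^sup>2 / w j)"
      using w_pos by (simp add: power_divide less_imp_le)
    also have "\<dots> \<le> W * (\<Sum>j<N. (T j)\<^sup>2 / w j)"
    proof (rule mult_right_mono)
      show "(\<Sum>j<N. w j) \<le> W"
        using sum_le_suminf[of w "{..<N}"] w w_pos by (auto simp: sums_iff less_imp_le)
      show "0 \<le> (\<Sum>j<N. (T j)\<^sup>2 / w j)"
        using w_pos by (intro sum_nonneg) (simp add: less_imp_le)
    qed
    finally have "ennreal ((\<Sum>j<N. T j)\<^sup>2) \<le> ennreal (W * (\<Sum>j<N. (T j)\<^sup>2 / w j))"
      by (rule ennreal_leI)
    also have "\<dots> = ennreal W * (\<Sum>j<N. ennreal ((T j)\<^sup>2 / w j))"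
      using w_pos by (subst ennreal_mult'') (auto intro!: sum_nonneg simp: less_imp_le)
    also have "\<dots> \<le> ennreal W * (\<Sum>j. ennreal ((T j)\<^sup>2 / w j))"
      by (intro mult_left_mono sum_le_suminf) auto
    finally show "ennreal ((\<Sum>j<N. T j)\<^sup>2) \<le> ennreal W * (\<Sum>j. ennreal ((T j)\<^sup>2 / w j))" .
  qed
qed

text \<open>
  The summands \<open>X i j\<close> may depend on each other across \<open>j\<close>, so each column \<open>j\<close> is bounded by itself
  and the columns are combined by the weighted Cauchy-Schwarz inequality. The weights
  \<open>(sqrt \<theta>)\<^sup>j\<close> lie halfway between \<open>\<theta>\<^sup>j\<close> and 1, so that both the weights and the quotients
  \<open>\<theta>\<^sup>j / (sqrt \<theta>)\<^sup>j\<close> are summable.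
\<close>

lemma nn_integral_centred_sum_square_le_of_summands:
  fixes X :: "nat \<Rightarrow> nat \<Rightarrow> 'w \<Rightarrow> real"
  assumes meas [measurable]: "\<And>i j. X i j \<in> borel_measurable M"
    and Y: "\<And>i \<omega>. (\<lambda>j. X i j \<omega>) sums Y i \<omega>" and p: "p sums \<mu>"
    and \<theta>: "0 < \<theta>" "\<theta> < 1" and C: "0 \<le> C"
    and var: "\<And>j. (\<integral>\<^sup>+\<omega>. ennreal (((\<Sum>i<n. X i j \<omega>) - real n * p j)\<^sup>2) \<partial>M) \<le> ennreal (C * \<theta> ^ j * real n)"
  shows "(\<integral>\<^sup>+\<omega>. ennreal (((\<Sum>i<n. Y i \<omega>) - real n * \<mu>)\<^sup>2) \<partial>M)
    \<le> ennreal (C / (1 - sqrt \<theta>)\<^sup>2 * real n)"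
proof -
  define w where "w = sqrt \<theta>"
  have w: "0 < w" "w < 1" "\<theta> = w\<^sup>2" using \<theta> by (auto simp: w_def)
  define T where "T = (\<lambda>j \<omega>. (\<Sum>i<n. X i j \<omega>) - real n * p j)"
  have [measurable]: "T j \<in> borel_measurable M" for j unfolding T_def by measurable
  have T: "(\<lambda>j. T j \<omega>) sums ((\<Sum>i<n. Y i \<omega>) - real n * \<mu>)" for \<omega>
    unfolding T_def by (intro sums_diff sums_sum sums_mult Y p)
  have W: "(\<lambda>j. w ^ j) sums (1 / (1 - w))"
    using w by (intro geometric_sums) auto
  have "(\<integral>\<^sup>+\<omega>. ennreal (((\<Sum>i<n. Y i \<omega>) - real n * \<mu>)\<^sup>2) \<partial>M)
      \<le> (\<integral>\<^sup>+\<omega>. ennreal (1 / (1 - w)) * (\<Sum>j. ennreal ((T j \<omega>)\<^sup>2 / w ^ j)) \<partial>M)"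
    using w by (intro nn_integral_mono square_suminf_le_weighted T W) auto
  also have "\<dots> = ennreal (1 / (1 - w)) * (\<Sum>j. \<integral>\<^sup>+\<omega>. ennreal ((T j \<omega>)\<^sup>2 / w ^ j) \<partial>M)"
    by (simp add: nn_integral_cmult nn_integral_suminf)
  also have "\<dots> \<le> ennreal (1 / (1 - w)) * (\<Sum>j. ennreal (C * real n * w ^ j))"
  proof (intro mult_left_mono suminf_le)
    fix j
    have "(\<integral>\<^sup>+\<omega>. ennreal ((T j \<omega>)\<^sup>2 / w ^ j) \<partial>M) = ennreal (1 / w ^ j) * (\<integral>\<^sup>+\<omega>. ennreal ((T j \<omega>)\<^sup>2) \<partial>M)"
      using w by (subst nn_integral_cmult[symmetric]) (simp_all flip: ennreal_mult)
    also have "\<dots> \<le> ennreal (1 / w ^ j) * ennreal (C * \<theta> ^ j * real n)"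
      using var[of j] by (intro mult_left_mono) (simp_all add: T_def)
    also have "\<dots> = ennreal (C * real n * w ^ j)"
      using w C by (subst ennreal_mult[symmetric]) (simp_all add: field_simps flip: power_mult power_add mult_2)
    finally show "(\<integral>\<^sup>+\<omega>. ennreal ((T j \<omega>)\<^sup>2 / w ^ j) \<partial>M) \<le> ennreal (C * real n * w ^ j)" .
  qed auto
  also have "(\<Sum>j. ennreal (C * real n * w ^ j)) = ennreal (C * real n * (1 / (1 - w)))"
    using sums_mult[OF W, of "C * real n"] w C
    by (subst suminf_ennreal2) (auto simp: sums_iff)
  also have "ennreal (1 / (1 - w)) * \<dots> = ennreal (C / (1 - w)\<^sup>2 * real n)"
    using w C by (subst ennreal_mult[symmetric]) (simp_all add: power2_eq_square)
  finally show ?thesis by (simp add: w_def)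
qed

lemma ext_hamming_sums:
  "(\<lambda>j. of_bool (site s j \<noteq> site t j)) sums real (ext_hamming s t)"
proof -
  have "(\<lambda>j. if j \<in> {j. site s j \<noteq> site t j} then 1 else 0 :: real) sums
      (\<Sum>j\<in>{j. site s j \<noteq> site t j}. 1)"
    by (rule sums_If_finite_set) (rule finite_differing_sites)
  thus ?thesis by (simp add: ext_hamming_def of_bool_def)
qed

lemma expectation_of_bool_site:
  "measure_pmf.expectation (map_pmf g Q) (\<lambda>x. of_bool (P x)) = measure_pmf.prob Q {t. P (g t)}"
proof -
  have "(\<lambda>t. of_bool (P (g t)) :: real) = indicator {t. P (g t)}"
    by (auto simp: fun_eq_iff)
  thus ?thesis by (subst integral_map_pmf) simp
qed

section \<open>Unknown centre and sitewise independence\<close>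

locale sitewise_indep_laplace_sample = prob_space M
  for M :: "'w measure" +
  fixes \<sigma> :: "nat \<Rightarrow> 'w \<Rightarrow> 'a::finite astring" and lam :: "'a astring" and \<rho> :: real
    and Q :: "'a astring pmf"
  assumes random_string: "\<And>i. random_string M (\<sigma> i)"
    and \<rho>_pos: "\<rho> > 0"
    and Q: "\<And>s. pmf Q s = laplace_like_pf ext_hamming lam \<rho> s"
    and law: "\<And>i. distr M (count_space UNIV) (\<sigma> i) = measure_pmf Q"
    and indep_sites: "\<And>j n. indep_vars (\<lambda>_. count_space UNIV) (\<lambda>i \<omega>. site (\<sigma> i \<omega>) j) {..<n}"
begin

lemma site_measurable [measurable]: "(\<lambda>\<omega>. site (\<sigma> i \<omega>) j) \<in> M \<rightarrow>\<^sub>M count_space UNIV"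
  using random_string by (simp add: random_string_def)

lemma site_law:
  "distr M (count_space UNIV) (\<lambda>\<omega>. site (\<sigma> i \<omega>) j) = measure_pmf (map_pmf (\<lambda>t. site t j) Q)"
  unfolding map_pmf_rep_eq law[of i, symmetric]
  by (subst distr_distr) (auto simp: comp_def intro: random_string_measurable[OF random_string])

lemma site_indep:
  "i \<noteq> k \<Longrightarrow> indep_var (count_space UNIV) (\<lambda>\<omega>. site (\<sigma> i \<omega>) j) (count_space UNIV) (\<lambda>\<omega>. site (\<sigma> k \<omega>) j)"
  by (rule indep_vars_imp_pairwise[OF indep_sites[of j "Suc (max i k)"]]) (auto simp: countable_finite)

lemma AE_rel_freq_tendsto:
  "AE \<omega> in M. \<forall>j x. (\<lambda>n. rel_freq (map (\<lambda>k. \<sigma> k \<omega>) [0..<n]) j x)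
     \<longlonglongrightarrow> measure_pmf.prob Q {t. site t j = x}"
proof -
  have "AE \<omega> in M. (\<lambda>n. (1 / real n) * (\<Sum>i<n. of_bool (site (\<sigma> i \<omega>) j = x)))
      \<longlonglongrightarrow> measure_pmf.prob Q {t. site t j = x}" for j x
    unfolding expectation_of_bool_site[of "\<lambda>t. site t j" Q "\<lambda>y. y = x", symmetric]
    by (rule AE_averages_tendsto_expectation[where X = "\<lambda>i \<omega>. site (\<sigma> i \<omega>) j" and f = "\<lambda>y. of_bool (y = x)",
        OF site_measurable site_law site_indep])
      (auto intro: measure_pmf.integrable_const_bound[where B = 1])
  moreover have "rel_freq (map (\<lambda>k. \<sigma> k \<omega>) [0..<n]) j x
      = (1 / real n) * (\<Sum>i<n. of_bool (site (\<sigma> i \<omega>) j = x))" for \<omega> n j x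
  proof -
    have "{i. i < n \<and> site (map (\<lambda>k. \<sigma> k \<omega>) [0..<n] ! i) j = x} = {i \<in> {..<n}. site (\<sigma> i \<omega>) j = x}"
      by auto
    thus ?thesis
      by (simp add: rel_freq_def sum.If_cases of_bool_def Int_def)
  qed
  ultimately show ?thesis
    by (simp add: AE_all_countable)
qed

definition mismatch_prob :: "nat \<Rightarrow> real" where
  "mismatch_prob j = measure_pmf.prob Q {t. site t j \<noteq> site lam j}"

lemma mismatch_prob_sums: "mismatch_prob sums \<rho>"
proof -
  note geo = geometric_mean_and_square[OF map_pmf_distance_eq_geometric[OF Q ext_hamming_commute \<rho>_pos] \<rho>_pos]
  have "ennreal \<rho> = (\<integral>\<^sup>+s. ennreal (real (ext_hamming s lam)) \<partial>measure_pmf Q)"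
    using geo by (subst nn_integral_eq_integral) auto
  also have "\<dots> = (\<integral>\<^sup>+s. (\<Sum>j. indicator {t. site t j \<noteq> site lam j} s) \<partial>measure_pmf Q)"
  proof (rule nn_integral_cong)
    fix s
    have "(\<Sum>j. ennreal (of_bool (site s j \<noteq> site lam j))) = ennreal (real (ext_hamming s lam))"
      using ext_hamming_sums[of s lam] by (subst suminf_ennreal2) (auto simp: sums_iff)
    moreover have "ennreal (of_bool (site s j \<noteq> site lam j)) = indicator {t. site t j \<noteq> site lam j} s" for j
      by (simp add: indicator_def)
    ultimately show "ennreal (real (ext_hamming s lam)) = (\<Sum>j. indicator {t. site t j \<noteq> site lam j} s)"
      by simp
  qed
  also have "\<dots> = (\<Sum>j. ennreal (mismatch_prob j))"
    by (simp add: nn_integral_suminf mismatch_prob_def measure_pmf.emeasure_eq_measure)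
  finally have eq: "(\<Sum>j. ennreal (mismatch_prob j)) = ennreal \<rho>" by simp
  have nonneg: "0 \<le> mismatch_prob j" for j by (simp add: mismatch_prob_def)
  have summ: "summable mismatch_prob"
    using eq nonneg by (intro summable_suminf_not_top) auto
  hence "suminf mismatch_prob = \<rho>"
    using eq nonneg \<rho>_pos suminf_nonneg[OF summ] by (simp add: suminf_ennreal2)
  thus ?thesis using summ by (simp add: sums_iff)
qed

text \<open>
  The constant \<open>1 / \<theta> ^ slen lam\<close> makes the bound at least 1 at the sites inside the centre, where
  no decay is available.
\<close>

lemma mismatch_prob_le:
  "mismatch_prob j \<le> (1 / (\<rho> / (\<rho> + 1)) ^ slen lam) * (\<rho> / (\<rho> + 1)) ^ j"
proof -
  define \<theta> where "\<theta> = \<rho> / (\<rho> + 1)"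
  have \<theta>: "0 < \<theta>" "\<theta> < 1" using \<rho>_pos by (auto simp: \<theta>_def field_simps)
  have "mismatch_prob j \<le> \<theta> ^ j / \<theta> ^ slen lam"
  proof (cases "slen lam \<le> j")
    case True
    hence "site lam j = None" by (simp add: site_eq_None_iff)
    hence "mismatch_prob j \<le> \<theta> ^ (Suc j - slen lam)"
      using prob_beyond_centre_le[OF Q \<rho>_pos True] by (simp add: mismatch_prob_def \<theta>_def)
    also have "\<dots> \<le> \<theta> ^ (j - slen lam)"
      using \<theta> by (intro power_decreasing) auto
    finally show ?thesis using \<theta> True by (simp add: power_diff)
  next
    case False
    have "mismatch_prob j \<le> 1" by (simp add: mismatch_prob_def)
    also have "1 \<le> \<theta> ^ j / \<theta> ^ slen lam"
      using \<theta> False power_decreasing[of j "slen lam" \<theta>] by (simp add: field_simps)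
    finally show ?thesis .
  qed
  thus ?thesis by (simp add: \<theta>_def)
qed

lemma AE_mean_distance_to_centre_tendsto:
  "AE \<omega> in M. (\<lambda>n. (1 / real n) * (\<Sum>i<n. real (ext_hamming (\<sigma> i \<omega>) lam))) \<longlonglongrightarrow> \<rho>"
proof (rule AE_averages_tendsto_if_variance_linear)
  define \<theta> where "\<theta> = \<rho> / (\<rho> + 1)"
  have \<theta>: "0 < \<theta>" "\<theta> < 1" using \<rho>_pos by (auto simp: \<theta>_def field_simps)
  define C where "C = 1 / \<theta> ^ slen lam"
  have C: "0 \<le> C" using \<theta> by (simp add: C_def)
  show "(\<lambda>\<omega>. real (ext_hamming (\<sigma> i \<omega>) lam)) \<in> borel_measurable M" for i
    by (rule measurable_compose[OF random_string_measurable[OF random_string]]) simp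
  show "0 \<le> C / (1 - sqrt \<theta>)\<^sup>2" using C by simp
  fix n
  show "(\<integral>\<^sup>+\<omega>. ennreal (((\<Sum>i<n. real (ext_hamming (\<sigma> i \<omega>) lam)) - real n * \<rho>)\<^sup>2) \<partial>M)
      \<le> ennreal (C / (1 - sqrt \<theta>)\<^sup>2 * real n)"
  proof (rule nn_integral_centred_sum_square_le_of_summands[OF _ ext_hamming_sums mismatch_prob_sums \<theta> C])
    fix j
    let ?P = "map_pmf (\<lambda>t. site t j) Q" and ?f = "\<lambda>x. of_bool (x \<noteq> site lam j) :: real"
    show "(\<lambda>\<omega>. of_bool (site (\<sigma> i \<omega>) j \<noteq> site lam j) :: real) \<in> borel_measurable M" for i
      by (rule measurable_compose[OF site_measurable]) simp
    have int: "integrable (measure_pmf ?P) g" if "\<And>x. \<bar>g x\<bar> \<le> 1" for g :: "'a option \<Rightarrow> real"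
      by (rule measure_pmf.integrable_const_bound[where B = 1]) (use that in auto)
    have mean: "measure_pmf.expectation ?P ?f = mismatch_prob j"
      by (simp only: expectation_of_bool_site mismatch_prob_def)
    \<comment> \<open>An indicator equals its square, so its variance is at most its mean.\<close>
    have "measure_pmf.variance ?P ?f = measure_pmf.expectation ?P (\<lambda>x. (?f x)\<^sup>2) - (mismatch_prob j)\<^sup>2"
      by (subst measure_pmf.variance_eq) (auto simp only: mean intro!: int; auto)+
    also have "(\<lambda>x. (?f x)\<^sup>2) = ?f" by (auto simp: fun_eq_iff)
    finally have "measure_pmf.variance ?P ?f \<le> mismatch_prob j" by (simp only: mean) simp
    also have "\<dots> \<le> C * \<theta> ^ j"
      using mismatch_prob_le[of j] by (simp add: C_def \<theta>_def)
    finally have var: "measure_pmf.variance ?P ?f \<le> C * \<theta> ^ j" .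
    have "(\<integral>\<^sup>+\<omega>. ennreal (((\<Sum>i<n. ?f (site (\<sigma> i \<omega>) j)) - real n * mismatch_prob j)\<^sup>2) \<partial>M)
        \<le> ennreal (measure_pmf.variance ?P ?f * real n)"
      unfolding mean[symmetric]
      by (rule nn_integral_centred_sum_square_le_of_law[where X = "\<lambda>i \<omega>. site (\<sigma> i \<omega>) j" and f = ?f,
          OF site_measurable site_law site_indep int int]) auto
    also have "\<dots> \<le> ennreal (C * \<theta> ^ j * real n)"
      by (intro ennreal_leI mult_right_mono var) simp
    finally show "(\<integral>\<^sup>+\<omega>. ennreal (((\<Sum>i<n. ?f (site (\<sigma> i \<omega>) j)) - real n * mismatch_prob j)\<^sup>2) \<partial>M)
        \<le> ennreal (C * \<theta> ^ j * real n)" .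
  qed
qed simp

lemma exists_site_with_None_strict_mode:
  obtains J where "slen lam \<le> J"
    and "\<And>a. measure_pmf.prob Q {t. site t J = Some a} < measure_pmf.prob Q {t. site t J = None}"
proof -
  have "mismatch_prob \<longlonglongrightarrow> 0"
    using mismatch_prob_sums by (intro summable_LIMSEQ_zero) (simp add: sums_iff)
  hence "\<forall>\<^sub>F j in sequentially. mismatch_prob j < 1 / 2 \<and> slen lam \<le> j"
    by (intro eventually_conj order_tendstoD(2) eventually_ge_at_top) auto
  then obtain J where J: "mismatch_prob J < 1 / 2" "slen lam \<le> J"
    using eventually_happens by force
  have "mismatch_prob J = measure_pmf.prob Q {t. site t J \<noteq> None}"
    using J by (simp add: mismatch_prob_def site_eq_None_iff[of lam, THEN iffD2])
  hence less: "measure_pmf.prob Q {t. site t J \<noteq> None} < 1 / 2"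
    using J by simp
  show ?thesis
  proof (rule that[OF J(2)])
    fix a
    have "measure_pmf.prob Q {t. site t J = Some a} \<le> measure_pmf.prob Q {t. site t J \<noteq> None}"
      by (rule measure_pmf.finite_measure_mono) auto
    moreover have "measure_pmf.prob Q {t. site t J = None} = 1 - measure_pmf.prob Q {t. site t J \<noteq> None}"
      by (subst measure_pmf.prob_compl[symmetric]) (auto intro: arg_cong[of _ _ "measure_pmf.prob Q"])
    ultimately show "measure_pmf.prob Q {t. site t J = Some a} < measure_pmf.prob Q {t. site t J = None}"
      using less by linarith
  qed
qed

lemma AE_mean_distance_to_consensus_tendsto:
  assumes card: "CARD('a) \<ge> 2" and \<eta>: "mode_rule \<eta>"
  shows "AE \<omega> in M. \<forall>\<^sub>F \<epsilon> in at_right 0.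
    (\<lambda>n. (1 / real n) * (\<Sum>i<n. real (ext_hamming (\<sigma> i \<omega>)
        (trunc_consensus \<eta> \<epsilon> (map (\<lambda>k. \<sigma> k \<omega>) [0..<n]))))) \<longlonglongrightarrow> \<rho>"
  using AE_rel_freq_tendsto AE_mean_distance_to_centre_tendsto
proof eventually_elim
  case (elim \<omega>)
  obtain J where J: "slen lam \<le> J"
    "\<And>a. measure_pmf.prob Q {t. site t J = Some a} < measure_pmf.prob Q {t. site t J = None}"
    using exists_site_with_None_strict_mode by blast
  have "\<forall>\<^sub>F \<epsilon> in at_right 0. \<forall>\<^sub>F n in sequentially.
      trunc_consensus \<eta> \<epsilon> (map (\<lambda>k. \<sigma> k \<omega>) [0..<n]) = lam"
    by (rule eventually_trunc_consensus_eq
        [where p = "\<lambda>j x. measure_pmf.prob Q {t. site t j = x}", OF _ card _ _ J \<eta>])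
      (use elim(1) centre_letter_strict_mode[OF Q \<rho>_pos card] prob_letter_eq_beyond_centre[OF Q \<rho>_pos] in auto)
  then show ?case
  proof eventually_elim
    case eq: (elim \<epsilon>)
    show ?case
      by (rule Lim_transform_eventually[OF elim(2)]) (use eq in eventually_elim, simp)
  qed
qed

end

section \<open>Consistency of the estimators of the dispersion parameter\<close>

theorem proposition2:
  fixes M :: "'w measure"
    and \<sigma> :: "nat \<Rightarrow> 'w \<Rightarrow> 'a::finite astring"
    and lam :: "'a astring"
    and \<rho> :: real
  assumes "prob_space M"
    and "\<And>i. random_string M (\<sigma> i)"
    and "\<rho> > 0"
  shows
    "(\<forall>d \<in> distance_functions.
        (\<forall>i. laplace_like_distributed M (\<sigma> i) d lam \<rho>) \<longrightarrow>
        (\<forall>n. indep_random_strings M \<sigma> n) \<longrightarrow>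
        (AE \<omega> in M. (\<lambda>n. (1 / real n) * (\<Sum>i<n. real (d (\<sigma> i \<omega>) lam))) \<longlonglongrightarrow> \<rho>))
     \<and>
     (CARD('a) \<ge> 2 \<longrightarrow>
      (\<forall>i. laplace_like_distributed M (\<sigma> i) ext_hamming lam \<rho>) \<longrightarrow>
      (\<forall>j n. prob_space.indep_vars M (\<lambda>_. count_space UNIV) (\<lambda>i \<omega>. site (\<sigma> i \<omega>) j) {..<n}) \<longrightarrow>
      (\<forall>\<eta>. mode_rule \<eta> \<longrightarrow>
        (AE \<omega> in M. \<exists>L :: real \<Rightarrow> real.
           (\<forall>\<^sub>F \<epsilon> in at_right 0.
              (\<lambda>n. (1 / real n) * (\<Sum>i<n. real (ext_hamming (\<sigma> i \<omega>)
                      (trunc_consensus \<eta> \<epsilon> (map (\<lambda>k. \<sigma> k \<omega>) [0..<n]))))) \<longlonglongrightarrow> L \<epsilon>)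
           \<and> (L \<longlongrightarrow> \<rho>) (at_right 0))))"
proof (intro conjI ballI impI allI)
  fix d
  assume "d \<in> distance_functions" "\<forall>i. laplace_like_distributed M (\<sigma> i) d lam \<rho>"
    "\<forall>n. indep_random_strings M \<sigma> n"
  thus "AE \<omega> in M. (\<lambda>n. (1 / real n) * (\<Sum>i<n. real (d (\<sigma> i \<omega>) lam))) \<longlonglongrightarrow> \<rho>"
    by (intro AE_mean_distance_tendsto_if_strings_indep assms) auto
next
  fix \<eta> :: "'a astring list \<Rightarrow> nat \<Rightarrow> 'a option"
  assume card: "CARD('a) \<ge> 2"
    and law: "\<forall>i. laplace_like_distributed M (\<sigma> i) ext_hamming lam \<rho>"
    and indep: "\<forall>j n. prob_space.indep_vars M (\<lambda>_. count_space UNIV) (\<lambda>i \<omega>. site (\<sigma> i \<omega>) j) {..<n}"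
    and \<eta>: "mode_rule \<eta>"
  obtain Q where Q: "\<And>s. pmf Q s = laplace_like_pf ext_hamming lam \<rho> s"
    "\<And>i. distr M (count_space UNIV) (\<sigma> i) = measure_pmf Q"
    using common_law_pmf[where \<sigma> = \<sigma>, OF assms(1,2) law[rule_format]] by metis
  interpret prob_space M by (rule assms(1))
  interpret sitewise_indep_laplace_sample M \<sigma> lam \<rho> Q
    using assms(2,3) Q indep by unfold_locales auto
  show "AE \<omega> in M. \<exists>L :: real \<Rightarrow> real.
      (\<forall>\<^sub>F \<epsilon> in at_right 0.
        (\<lambda>n. (1 / real n) * (\<Sum>i<n. real (ext_hamming (\<sigma> i \<omega>)
          (trunc_consensus \<eta> \<epsilon> (map (\<lambda>k. \<sigma> k \<omega>) [0..<n]))))) \<longlonglongrightarrow> L \<epsilon>)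
      \<and> (L \<longlongrightarrow> \<rho>) (at_right 0)"
    using AE_mean_distance_to_consensus_tendsto[OF card \<eta>]
  proof eventually_elim
    case (elim \<omega>)
    \<comment> \<open>For small \<open>\<epsilon>\<close> the limit in \<open>n\<close> is already \<open>\<rho>\<close>.\<close>
    then show ?case by (intro exI[of _ "\<lambda>_. \<rho>"]) simp
  qed
qed

end
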